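(* Let $p_1,\ldots,p_\ell$ be homogeneous generators of $\mathbb C[\mathfrak g]^G$, with degrees $d_1,\ldots,d_\ell$. On the nilpotent-residue locus, the logarithmic Hitchin map $(P,\Phi)\mapsto(p_1(\Phi),\ldots,p_\ell(\Phi))$ takes values in $$\bigoplus_{j=1}^{\ell}H^0\bigl(C,K_C^{d_j}((d_j-1)D)\bigr).$$ Equivalently, the usual logarithmic Hitchin map (with values in $\bigoplus_{j=1}^{\ell}H^0(C,K_C^{d_j}(d_jD))$) factors, on the nilpotent-residue locus, as $$h_{G,\log}^{\mathrm{nil}}:\mathcal M_{\mathrm{Dol}}^{\mathrm{nil}}(G)\longrightarrow\bigoplus_{j=1}^{\ell}H^0\bigl(C,K_C^{d_j}((d_j-1)D)\bigr).$$
   Context: $C$ is a compact Riemann surface of genus at least $2$ with canonical bundle $K_C$, and $D$ is a reduced divisor on $C$ (the marked points). $G$ is a connected complex reductive group with Lie algebra $\mathfrak g=\mathfrak z(\mathfrak g)\oplus[\mathfrak g,\mathfrak g]$; $\mathbb C[\mathfrak g]^G$ is the ring of $\operatorname{Ad}$-invariant polynomials on $\mathfrak g$, and the generators have positive degree. A logarithmic $G$-Higgs bundle on $(C,D)$ is a pair $(P,\Phi)$ where $P$ is a holomorphic principal $G$-bundle on $C$ and $\Phi\in H^0(C,\operatorname{ad}(P)\otimes K_C(D))$, with $\operatorname{ad}(P)=P\times^G\mathfrak g$. In a coordinate $z$ centred at a point $x\in D$ and a local trivialization, $\Phi=\left(\frac{N}{z}+A(z)\right)dz$ with $A$ holomorphic,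 and $N=\operatorname{Res}_x(\Phi)\in\mathfrak g$. An element $N\in\mathfrak g$ is called nilpotent if its component in $\mathfrak z(\mathfrak g)$ is zero and its component in $[\mathfrak g,\mathfrak g]$ is nilpotent; $\Phi$ has nilpotent residues if $\operatorname{Res}_x(\Phi)$ is nilpotent for every $x\in D$. For a homogeneous invariant polynomial $p$ of degree $d$, $p(\Phi)$ is the meromorphic section of $K_C^d$ given locally by $p(s(z))\,dz^d$ when $\Phi=s(z)\,dz$. $\mathcal M_{\mathrm{Dol}}^{\mathrm{nil}}(G)\to\mathcal T_{g,r}$ denotes a fixed smooth stable family over the Teichmüller space of pointed Riemann surfaces of type $(g,r)$, whose fibre over $(C,D)$ is a smooth stable locus in the moduli space of logarithmic $G$-Higgs bundles on $(C,D)$ with fixed topological type and nilpotent residues. The Hitchin map is considered fibrewise over $(C,D)$. *)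

theory Defs
  imports
    "HOL-Analysis.Analysis"
    "HOL-Complex_Analysis.Complex_Analysis"
    "HOL-Homology.Homology"
begin

section \<open>Complex matrix groups and their Lie algebras\<close>

type_synonym 'n cmat = "complex^'n^'n"

definition cscale :: "complex \<Rightarrow> 'n::finite cmat \<Rightarrow> 'n cmat" where
  "cscale c X = (\<chi> i j. c * X $ i $ j)"

interpretation cmat: vector_space "cscale :: complex \<Rightarrow> 'n::finite cmat \<Rightarrow> 'n cmat"
  by unfold_locales (simp_all add: cscale_def vec_eq_iff algebra_simps)

definition matrix_subgroup :: "'n::finite cmat set \<Rightarrow> bool" where
  "matrix_subgroup G \<longleftrightarrow>
     (\<forall>g\<in>G. invertible g) \<and> mat 1 \<in> G \<and> (\<forall>g\<in>G. \<forall>h\<in>G. g ** h \<in> G) \<and> (\<forall>g\<in>G. matrix_inv g \<in> G)"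

text \<open>The tangent space at the identity, as the set of velocities of curves in the group.  For a
  closed subgroup of the general linear group, requiring differentiability of the curve only at
  \<open>0\<close> gives the same set as requiring smoothness.\<close>

definition lie_alg :: "'n::finite cmat set \<Rightarrow> 'n cmat set" where
  "lie_alg G = {X. \<exists>\<gamma>::real \<Rightarrow> 'n cmat.
     (\<forall>t. \<gamma> t \<in> G) \<and> \<gamma> 0 = mat 1 \<and> (\<gamma> has_vector_derivative X) (at 0)}"

text \<open>A connected complex reductive group is the complexification of a compact Lie group \<open>K\<close>:
  its Lie algebra is the direct sum of that of \<open>K\<close> and \<open>\<i>\<close> times that of \<open>K\<close>.  Such groups have
  faithful finite-dimensional holomorphic representations, so they are taken here as closed
  subgroups of a general linear group; the size of the matrices is arbitrary.\<close>

definition connected_complex_reductive :: "'n::finite cmat set \<Rightarrow> bool" where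
  "connected_complex_reductive G \<longleftrightarrow>
     matrix_subgroup G \<and>
     closedin (top_of_set {g. invertible g}) G \<and>
     connected G \<and>
     (\<exists>K\<subseteq>G. matrix_subgroup K \<and> compact K \<and>
        lie_alg G = {X + cscale \<i> Y | X Y. X \<in> lie_alg K \<and> Y \<in> lie_alg K} \<and>
        lie_alg K \<inter> cscale \<i> ` lie_alg K = {0})"

definition Ad :: "'n::finite cmat \<Rightarrow> 'n cmat \<Rightarrow> 'n cmat" where
  "Ad g X = g ** X ** matrix_inv g"

definition bracket :: "'n::finite cmat \<Rightarrow> 'n cmat \<Rightarrow> 'n cmat" where
  "bracket X Y = X ** Y - Y ** X"

definition lie_center :: "'n::finite cmat set \<Rightarrow> 'n cmat set" where
  "lie_center \<gg> = {Z \<in> \<gg>. \<forall>Y\<in>\<gg>. bracket Z Y = 0}"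

definition lie_derived :: "'n::finite cmat set \<Rightarrow> 'n cmat set" where
  "lie_derived \<gg> = cmat.span {bracket X Y | X Y. X \<in> \<gg> \<and> Y \<in> \<gg>}"

text \<open>Nilpotency in the semisimple Lie algebra \<open>lie_derived \<gg>\<close> is nilpotency of the adjoint
  action on it; a central matrix that happens to be nilpotent is not nilpotent in this sense.\<close>

definition lie_nilpotent :: "'n::finite cmat set \<Rightarrow> 'n cmat \<Rightarrow> bool" where
  "lie_nilpotent \<gg> N \<longleftrightarrow>
     (\<exists>Z\<in>lie_center \<gg>. \<exists>S\<in>lie_derived \<gg>. N = Z + S \<and> Z = 0 \<and>
        (\<exists>k. \<forall>Y\<in>lie_derived \<gg>. (bracket S ^^ k) Y = 0))"


section \<open>Invariant polynomials\<close>

inductive cpoly :: "('n::finite cmat \<Rightarrow> complex) \<Rightarrow> bool" where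
  "cpoly (\<lambda>X. c)"
| "cpoly (\<lambda>X. X $ i $ j)"
| "cpoly f \<Longrightarrow> cpoly g \<Longrightarrow> cpoly (\<lambda>X. f X + g X)"
| "cpoly f \<Longrightarrow> cpoly g \<Longrightarrow> cpoly (\<lambda>X. f X * g X)"

text \<open>Polynomials on the subspace \<open>lie_alg G\<close> are represented by functions on all matrices, of
  which only the values on \<open>lie_alg G\<close> matter.\<close>

definition invariant_poly :: "'n::finite cmat set \<Rightarrow> ('n cmat \<Rightarrow> complex) \<Rightarrow> bool" where
  "invariant_poly G f \<longleftrightarrow>
     (\<exists>F. cpoly F \<and> (\<forall>X\<in>lie_alg G. f X = F X)) \<and>
     (\<forall>g\<in>G. \<forall>X\<in>lie_alg G. f (Ad g X) = f X)"

definition homogeneous :: "'n::finite cmat set \<Rightarrow> nat \<Rightarrow> ('n cmat \<Rightarrow> complex) \<Rightarrow> bool" where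
  "homogeneous G d f \<longleftrightarrow> (\<forall>c. \<forall>X\<in>lie_alg G. f (cscale c X) = c ^ d * f X)"

inductive generated_alg ::
  "nat \<Rightarrow> (nat \<Rightarrow> 'n::finite cmat \<Rightarrow> complex) \<Rightarrow> ('n cmat \<Rightarrow> complex) \<Rightarrow> bool"
  for l p where
  "generated_alg l p (\<lambda>X. c)"
| "j < l \<Longrightarrow> generated_alg l p (p j)"
| "generated_alg l p f \<Longrightarrow> generated_alg l p g \<Longrightarrow> generated_alg l p (\<lambda>X. f X + g X)"
| "generated_alg l p f \<Longrightarrow> generated_alg l p g \<Longrightarrow> generated_alg l p (\<lambda>X. f X * g X)"

definition homogeneous_generators ::
  "'n::finite cmat set \<Rightarrow> nat \<Rightarrow> (nat \<Rightarrow> 'n cmat \<Rightarrow> complex) \<Rightarrow> (nat \<Rightarrow> nat) \<Rightarrow> bool" where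
  "homogeneous_generators G l p d \<longleftrightarrow>
     (\<forall>j<l. invariant_poly G (p j) \<and> homogeneous G (d j) (p j) \<and> d j > 0) \<and>
     (\<forall>f. invariant_poly G f \<longrightarrow>
        (\<exists>h. generated_alg l p h \<and> (\<forall>X\<in>lie_alg G. f X = h X)))"


section \<open>Riemann surfaces\<close>

text \<open>A chart is an open set together with a coordinate on it; values of the coordinate
  outside the open set are irrelevant.\<close>

type_synonym 'c chart = "'c set \<times> ('c \<Rightarrow> complex)"

definition chart_pt :: "'c chart \<Rightarrow> complex \<Rightarrow> 'c" where
  "chart_pt c = inv_into (fst c) (snd c)"

definition is_chart :: "'c::topological_space chart \<Rightarrow> bool" where
  "is_chart c \<longleftrightarrow>
     open (fst c) \<and> open (snd c ` fst c) \<and>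
     homeomorphism (fst c) (snd c ` fst c) (snd c) (chart_pt c)"

definition compatible :: "'c chart \<Rightarrow> 'c chart \<Rightarrow> bool" where
  "compatible b c \<longleftrightarrow>
     (snd b \<circ> chart_pt c) holomorphic_on (snd c ` (fst b \<inter> fst c)) \<and>
     (snd c \<circ> chart_pt b) holomorphic_on (snd b ` (fst b \<inter> fst c))"

text \<open>A complex structure on a surface is a maximal holomorphic atlas.\<close>

definition complex_structure :: "'c::topological_space chart set \<Rightarrow> bool" where
  "complex_structure A \<longleftrightarrow>
     (\<forall>c\<in>A. is_chart c) \<and> (\<Union>c\<in>A. fst c) = UNIV \<and>
     (\<forall>b\<in>A. \<forall>c\<in>A. compatible b c) \<and>
     (\<forall>c. is_chart c \<and> (\<forall>b\<in>A. compatible b c) \<longrightarrow> c \<in> A)"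

text \<open>A Riemann surface whose underlying space is the whole type; Hausdorffness is imposed by
  the type class.  The genus is half the rank of the first integral homology group.\<close>

definition compact_riemann_surface :: "nat \<Rightarrow> 'c::t2_space chart set \<Rightarrow> bool" where
  "compact_riemann_surface g A \<longleftrightarrow>
     complex_structure A \<and> compact (UNIV :: 'c set) \<and> connected (UNIV :: 'c set) \<and>
     is_iso (homology_group 1 (euclidean :: 'c topology)) (free_Abelian_group {..<2 * g})"

text \<open>The derivative at \<open>x\<close> of the coordinate of \<open>b\<close> with respect to the coordinate of \<open>c\<close>.\<close>

definition jac :: "'c chart \<Rightarrow> 'c chart \<Rightarrow> 'c \<Rightarrow> complex" where
  "jac b c x = deriv (snd b \<circ> chart_pt c) (snd c x)"

definition pole_le :: "nat \<Rightarrow> (complex \<Rightarrow> complex) \<Rightarrow> complex \<Rightarrow> bool" where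
  "pole_le m f a \<longleftrightarrow>
     (\<exists>h. h analytic_on {a} \<and> (\<forall>\<^sub>F y in at a. (y - a) ^ m * f y = h y))"

text \<open>\<open>log_differentials A D d m\<close> is the space of global sections of the \<open>d\<close>-th power of the
  canonical bundle twisted by \<open>m D\<close>.  A section is given by its restriction to the complement
  of \<open>D\<close>: \<open>q c x\<close> is the coefficient at \<open>x\<close> of the \<open>d\<close>-th power of the differential of the
  coordinate \<open>c\<close>, set to \<open>0\<close> where this has no meaning.\<close>

definition log_differentials ::
  "'c::topological_space chart set \<Rightarrow> 'c set \<Rightarrow> nat \<Rightarrow> nat \<Rightarrow> ('c chart \<Rightarrow> 'c \<Rightarrow> complex) set" where
  "log_differentials A D d m = {q.
     (\<forall>c x. c \<notin> A \<or> x \<notin> fst c - D \<longrightarrow> q c x = 0) \<and>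
     (\<forall>b\<in>A. \<forall>c\<in>A. \<forall>x\<in>fst b \<inter> fst c - D. q c x = q b x * jac b c x ^ d) \<and>
     (\<forall>c\<in>A. (\<lambda>y. q c (chart_pt c y)) holomorphic_on (snd c ` (fst c - D))) \<and>
     (\<forall>c\<in>A. \<forall>x\<in>fst c \<inter> D. pole_le m (\<lambda>y. q c (chart_pt c y)) (snd c x))}"


section \<open>Principal bundles\<close>

text \<open>The field \<open>triv\<close> consists of local sections (an open set and a map on it), each of which
  amounts to a local trivialization; together they cover the base.\<close>

record ('p, 'c, 'n) pbundle =
  total :: "'p set"
  proj :: "'p \<Rightarrow> 'c"
  act :: "'p \<Rightarrow> 'n cmat \<Rightarrow> 'p"
  triv :: "('c set \<times> ('c \<Rightarrow> 'p)) set"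

definition local_section :: "('p, 'c::topological_space, 'n::finite) pbundle \<Rightarrow> 'c set \<times> ('c \<Rightarrow> 'p) \<Rightarrow> bool" where
  "local_section P s \<longleftrightarrow>
     open (fst s) \<and> (\<forall>x\<in>fst s. snd s x \<in> total P \<and> proj P (snd s x) = x)"

definition quot :: "'n::finite cmat set \<Rightarrow> ('p, 'c, 'n) pbundle \<Rightarrow> 'p \<Rightarrow> 'p \<Rightarrow> 'n cmat" where
  "quot G P a b = (THE g. g \<in> G \<and> act P a g = b)"

definition torsor_bundle :: "'n::finite cmat set \<Rightarrow> ('p, 'c::topological_space, 'n) pbundle \<Rightarrow> bool" where
  "torsor_bundle G P \<longleftrightarrow>
     (\<forall>a\<in>total P. \<forall>g\<in>G. act P a g \<in> total P \<and> proj P (act P a g) = proj P a) \<and>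
     (\<forall>a\<in>total P. act P a (mat 1) = a) \<and>
     (\<forall>a\<in>total P. \<forall>g\<in>G. \<forall>h\<in>G. act P (act P a g) h = act P a (g ** h)) \<and>
     (\<forall>a\<in>total P. \<forall>b\<in>total P. proj P a = proj P b \<longrightarrow> (\<exists>!g. g \<in> G \<and> act P a g = b)) \<and>
     (\<forall>s\<in>triv P. local_section P s) \<and> (\<Union>s\<in>triv P. fst s) = UNIV"

definition topological_principal_bundle ::
  "'n::finite cmat set \<Rightarrow> ('p, 'c::topological_space, 'n) pbundle \<Rightarrow> bool" where
  "topological_principal_bundle G P \<longleftrightarrow> torsor_bundle G P \<and>
     (\<forall>s\<in>triv P. \<forall>t\<in>triv P. continuous_on (fst s \<inter> fst t) (\<lambda>x. quot G P (snd s x) (snd t x)))"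

definition holo_matrix ::
  "'c::topological_space chart set \<Rightarrow> 'c set \<Rightarrow> ('c \<Rightarrow> 'n::finite cmat) \<Rightarrow> bool" where
  "holo_matrix A W f \<longleftrightarrow>
     (\<forall>c\<in>A. \<forall>i j. (\<lambda>y. f (chart_pt c y) $ i $ j) holomorphic_on (snd c ` (fst c \<inter> W)))"

definition holomorphic_principal_bundle ::
  "'c::topological_space chart set \<Rightarrow> 'n::finite cmat set \<Rightarrow> ('p, 'c, 'n) pbundle \<Rightarrow> bool" where
  "holomorphic_principal_bundle A G P \<longleftrightarrow> torsor_bundle G P \<and>
     (\<forall>s\<in>triv P. \<forall>t\<in>triv P. holo_matrix A (fst s \<inter> fst t) (\<lambda>x. quot G P (snd s x) (snd t x)))"

definition bundle_map ::
  "'n::finite cmat set \<Rightarrow> ('p, 'c::topological_space, 'n) pbundle \<Rightarrow> ('p, 'c, 'n) pbundle \<Rightarrow> ('p \<Rightarrow> 'p) \<Rightarrow> bool" where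
  "bundle_map G P P' f \<longleftrightarrow>
     (\<forall>a\<in>total P. f a \<in> total P' \<and> proj P' (f a) = proj P a) \<and>
     (\<forall>a\<in>total P. \<forall>g\<in>G. f (act P a g) = act P' (f a) g)"

definition same_topological_type ::
  "'n::finite cmat set \<Rightarrow> ('p, 'c::topological_space, 'n) pbundle \<Rightarrow> ('p, 'c, 'n) pbundle \<Rightarrow> bool" where
  "same_topological_type G P P' \<longleftrightarrow> (\<exists>f. bundle_map G P P' f \<and>
     (\<forall>s\<in>triv P. \<forall>t\<in>triv P'.
        continuous_on (fst s \<inter> fst t) (\<lambda>x. quot G P' (snd t x) (f (snd s x)))))"


section \<open>Logarithmic Higgs bundles\<close>

text \<open>The class of \<open>(a, X)\<close> in the associated bundle of Lie algebras, the quotient of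
  \<open>total P \<times> lie_alg G\<close> by \<open>(act P a g, X) \<sim> (a, Ad g X)\<close>.\<close>

definition ad_class ::
  "'n::finite cmat set \<Rightarrow> ('p, 'c, 'n) pbundle \<Rightarrow> 'p \<Rightarrow> 'n cmat \<Rightarrow> ('p \<times> 'n cmat) set" where
  "ad_class G P a X = {(act P a g, Ad (matrix_inv g) X) | g. g \<in> G}"

definition ad_fibre ::
  "'n::finite cmat set \<Rightarrow> ('p, 'c, 'n) pbundle \<Rightarrow> 'c \<Rightarrow> ('p \<times> 'n cmat) set set" where
  "ad_fibre G P x = {ad_class G P a X | a X. a \<in> total P \<and> proj P a = x \<and> X \<in> lie_alg G}"

definition ad_scale :: "complex \<Rightarrow> ('p \<times> 'n::finite cmat) set \<Rightarrow> ('p \<times> 'n cmat) set" where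
  "ad_scale c e = {(a, cscale c X) | a X. (a, X) \<in> e}"

definition ad_coord :: "('p \<times> 'n::finite cmat) set \<Rightarrow> 'p \<Rightarrow> 'n cmat" where
  "ad_coord e a = (THE X. (a, X) \<in> e)"

text \<open>A Higgs field assigns to a chart \<open>c\<close> and a point \<open>x\<close> of its domain outside \<open>D\<close> the
  element of the fibre of the adjoint bundle at \<open>x\<close> by which the differential of the coordinate
  of \<open>c\<close> is multiplied.  In a local trivialization \<open>s\<close> it becomes \<open>higgs_coeff \<Phi> c s y\<close> times
  that differential, as a function of the coordinate \<open>y\<close>.\<close>

type_synonym ('p, 'c, 'n) higgs_field = "'c chart \<Rightarrow> 'c \<Rightarrow> ('p \<times> 'n cmat) set"

definition higgs_coeff ::
  "('p, 'c, 'n::finite) higgs_field \<Rightarrow> 'c chart \<Rightarrow> 'c set \<times> ('c \<Rightarrow> 'p) \<Rightarrow> complex \<Rightarrow> 'n cmat" where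
  "higgs_coeff \<Phi> c s y = ad_coord (\<Phi> c (chart_pt c y)) (snd s (chart_pt c y))"

definition log_higgs_field ::
  "'c::topological_space chart set \<Rightarrow> 'c set \<Rightarrow> 'n::finite cmat set \<Rightarrow> ('p, 'c, 'n) pbundle
     \<Rightarrow> ('p, 'c, 'n) higgs_field \<Rightarrow> bool" where
  "log_higgs_field A D G P \<Phi> \<longleftrightarrow>
     (\<forall>c\<in>A. \<forall>x\<in>fst c - D. \<Phi> c x \<in> ad_fibre G P x) \<and>
     (\<forall>b\<in>A. \<forall>c\<in>A. \<forall>x\<in>fst b \<inter> fst c - D. \<Phi> c x = ad_scale (jac b c x) (\<Phi> b x)) \<and>
     (\<forall>c\<in>A. \<forall>s\<in>triv P. \<forall>i j.
        (\<lambda>y. higgs_coeff \<Phi> c s y $ i $ j) holomorphic_on (snd c ` (fst c \<inter> fst s - D)) \<and>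
        (\<forall>x\<in>fst c \<inter> fst s \<inter> D. pole_le 1 (\<lambda>y. higgs_coeff \<Phi> c s y $ i $ j) (snd c x)))"

definition log_higgs_bundles ::
  "'c::topological_space chart set \<Rightarrow> 'c set \<Rightarrow> 'n::finite cmat set
     \<Rightarrow> (('p, 'c, 'n) pbundle \<times> ('p, 'c, 'n) higgs_field) set" where
  "log_higgs_bundles A D G =
     {(P, \<Phi>). holomorphic_principal_bundle A G P \<and> log_higgs_field A D G P \<Phi>}"

definition higgs_residue ::
  "('p, 'c, 'n::finite) higgs_field \<Rightarrow> 'c chart \<Rightarrow> 'c set \<times> ('c \<Rightarrow> 'p) \<Rightarrow> 'c \<Rightarrow> 'n cmat" where
  "higgs_residue \<Phi> c s x = (\<chi> i j. residue (\<lambda>y. higgs_coeff \<Phi> c s y $ i $ j) (snd c x))"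

definition nilpotent_residues ::
  "'c::topological_space chart set \<Rightarrow> 'c set \<Rightarrow> 'n::finite cmat set \<Rightarrow> ('p, 'c, 'n) pbundle
     \<Rightarrow> ('p, 'c, 'n) higgs_field \<Rightarrow> bool" where
  "nilpotent_residues A D G P \<Phi> \<longleftrightarrow>
     (\<forall>x\<in>D. \<forall>c\<in>A. \<forall>s\<in>triv P. x \<in> fst c \<inter> fst s \<longrightarrow>
        lie_nilpotent (lie_alg G) (higgs_residue \<Phi> c s x))"

definition higgs_iso ::
  "'c::topological_space chart set \<Rightarrow> 'c set \<Rightarrow> 'n::finite cmat set
     \<Rightarrow> ((('p, 'c, 'n) pbundle \<times> ('p, 'c, 'n) higgs_field) \<times>
         (('p, 'c, 'n) pbundle \<times> ('p, 'c, 'n) higgs_field)) set" where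
  "higgs_iso A D G = {((P, \<Phi>), (P', \<Phi>')).
     (P, \<Phi>) \<in> log_higgs_bundles A D G \<and> (P', \<Phi>') \<in> log_higgs_bundles A D G \<and>
     (\<exists>f. bundle_map G P P' f \<and>
        (\<forall>s\<in>triv P. \<forall>t\<in>triv P'.
           holo_matrix A (fst s \<inter> fst t) (\<lambda>x. quot G P' (snd t x) (f (snd s x)))) \<and>
        (\<forall>c\<in>A. \<forall>x\<in>fst c - D. \<Phi>' c x = {(f a, X) | a X. (a, X) \<in> \<Phi> c x}))}"

definition higgs_moduli ::
  "'c::topological_space chart set \<Rightarrow> 'c set \<Rightarrow> 'n::finite cmat set
     \<Rightarrow> (('p, 'c, 'n) pbundle \<times> ('p, 'c, 'n) higgs_field) set set" where
  "higgs_moduli A D G = log_higgs_bundles A D G // higgs_iso A D G"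


section \<open>Stability\<close>

text \<open>The group \<open>G\<close> below is reductive, hence Zariski closed in the general linear group.
  A subgroup is parabolic if it is Zariski closed and \<open>G/Q\<close> is complete, that is, compact.\<close>

definition parabolic :: "'n::finite cmat set \<Rightarrow> 'n cmat set \<Rightarrow> bool" where
  "parabolic G Q \<longleftrightarrow>
     matrix_subgroup Q \<and> (\<exists>F\<subseteq>Collect cpoly. Q = {g\<in>G. \<forall>f\<in>F. f g = 0}) \<and>
     (\<exists>L\<subseteq>G. compact L \<and> G = {k ** q | k q. k \<in> L \<and> q \<in> Q})"

definition holomorphic_section ::
  "'c::topological_space chart set \<Rightarrow> 'n::finite cmat set \<Rightarrow> ('p, 'c, 'n) pbundle
     \<Rightarrow> 'c set \<times> ('c \<Rightarrow> 'p) \<Rightarrow> bool" where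
  "holomorphic_section A G P s \<longleftrightarrow> local_section P s \<and>
     (\<forall>t\<in>triv P. holo_matrix A (fst s \<inter> fst t) (\<lambda>x. quot G P (snd t x) (snd s x)))"

text \<open>\<open>R\<close> is the total space of a holomorphic reduction of structure group of \<open>P\<close> to \<open>Q\<close>.\<close>

definition reduction ::
  "'c::topological_space chart set \<Rightarrow> 'n::finite cmat set \<Rightarrow> ('p, 'c, 'n) pbundle
     \<Rightarrow> 'n cmat set \<Rightarrow> 'p set \<Rightarrow> bool" where
  "reduction A G P Q R \<longleftrightarrow> R \<subseteq> total P \<and>
     (\<forall>a\<in>R. \<forall>g\<in>G. act P a g \<in> R \<longleftrightarrow> g \<in> Q) \<and>
     (\<forall>x. \<exists>s. x \<in> fst s \<and> holomorphic_section A G P s \<and> snd s ` fst s \<subseteq> R)"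

definition higgs_invariant ::
  "'c::topological_space chart set \<Rightarrow> 'c set \<Rightarrow> ('p, 'c, 'n::finite) pbundle
     \<Rightarrow> ('p, 'c, 'n) higgs_field \<Rightarrow> 'n cmat set \<Rightarrow> 'p set \<Rightarrow> bool" where
  "higgs_invariant A D P \<Phi> Q R \<longleftrightarrow>
     (\<forall>a\<in>R. \<forall>c\<in>A. proj P a \<in> fst c - D \<longrightarrow> ad_coord (\<Phi> c (proj P a)) a \<in> lie_alg Q)"

definition det_on :: "'n::finite cmat set \<Rightarrow> ('n cmat \<Rightarrow> 'n cmat) \<Rightarrow> complex" where
  "det_on V f =
     (let B = (SOME B. cmat.independent B \<and> cmat.span B = V)
      in \<Sum>\<pi> | \<pi> permutes B. of_int (sign \<pi>) * (\<Prod>b\<in>B. cmat.representation B (f b) (\<pi> b)))"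

text \<open>The determinant of the adjoint action on the quotient of \<open>lie_alg G\<close> by \<open>lie_alg Q\<close>.\<close>

definition quot_char :: "'n::finite cmat set \<Rightarrow> 'n cmat set \<Rightarrow> 'n cmat \<Rightarrow> complex" where
  "quot_char G Q q = det_on (lie_alg G) (Ad q) / det_on (lie_alg Q) (Ad q)"

text \<open>\<open>char_degree A G P R Q \<theta> k\<close>: the line bundle associated with the \<open>Q\<close>-bundle \<open>R\<close> and the
  character \<open>\<theta>\<close> has a nonzero meromorphic section whose divisor \<open>\<delta>\<close> has degree \<open>k\<close>.  A section
  is an equivariant function \<open>u\<close> on \<open>R\<close>.\<close>

definition char_degree ::
  "'c::topological_space chart set \<Rightarrow> 'n::finite cmat set \<Rightarrow> ('p, 'c, 'n) pbundle \<Rightarrow> 'p set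
     \<Rightarrow> 'n cmat set \<Rightarrow> ('n cmat \<Rightarrow> complex) \<Rightarrow> int \<Rightarrow> bool" where
  "char_degree A G P R Q \<theta> k \<longleftrightarrow> (\<exists>u \<delta>.
     (\<forall>a\<in>R. \<forall>q\<in>Q. u (act P a q) = inverse (\<theta> q) * u a) \<and>
     (\<forall>c\<in>A. \<forall>s. holomorphic_section A G P s \<and> snd s ` fst s \<subseteq> R \<longrightarrow>
        (\<lambda>y. u (snd s (chart_pt c y))) meromorphic_on (snd c ` (fst c \<inter> fst s)) \<and>
        (\<forall>x\<in>fst c \<inter> fst s.
           (\<exists>\<^sub>F y in at (snd c x). u (snd s (chart_pt c y)) \<noteq> 0) \<and>
           zorder (\<lambda>y. u (snd s (chart_pt c y))) (snd c x) = \<delta> x)) \<and>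
     finite {x. \<delta> x \<noteq> 0} \<and> k = (\<Sum>x | \<delta> x \<noteq> 0. \<delta> x))"

text \<open>Ramanathan's criterion, tested on reductions that contain the Higgs field: the quotient
  of the adjoint bundle of \<open>P\<close> by that of the reduction (the pull-back of the vertical tangent
  bundle of \<open>P/Q\<close>) has positive degree.\<close>

definition stable ::
  "'c::topological_space chart set \<Rightarrow> 'c set \<Rightarrow> 'n::finite cmat set \<Rightarrow> ('p, 'c, 'n) pbundle
     \<Rightarrow> ('p, 'c, 'n) higgs_field \<Rightarrow> bool" where
  "stable A D G P \<Phi> \<longleftrightarrow>
     (\<forall>Q R. parabolic G Q \<and> Q \<noteq> G \<and> reduction A G P Q R \<and> higgs_invariant A D P \<Phi> Q R \<longrightarrow>
        (\<exists>k>0. char_degree A G P R Q (quot_char G Q) k))"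

definition stable_nil_moduli ::
  "'c::topological_space chart set \<Rightarrow> 'c set \<Rightarrow> 'n::finite cmat set \<Rightarrow> ('p, 'c, 'n) pbundle
     \<Rightarrow> (('p, 'c, 'n) pbundle \<times> ('p, 'c, 'n) higgs_field) set set" where
  "stable_nil_moduli A D G P\<^sub>0 = {E \<in> higgs_moduli A D G. \<forall>(P, \<Phi>)\<in>E.
     stable A D G P \<Phi> \<and> nilpotent_residues A D G P \<Phi> \<and> same_topological_type G P\<^sub>0 P}"


section \<open>Teichmueller space\<close>

definition same_orientation :: "'c chart set \<Rightarrow> 'c chart set \<Rightarrow> bool" where
  "same_orientation A B \<longleftrightarrow>
     (\<forall>b\<in>A. \<forall>c\<in>B. \<forall>x\<in>fst b \<inter> fst c. \<forall>\<^sub>F r in at_right 0.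
        winding_number (snd c \<circ> chart_pt b \<circ> circlepath (snd b x) r) (snd c x) = 1)"

definition isotopic_to_id_rel :: "'c::topological_space set \<Rightarrow> ('c \<Rightarrow> 'c) \<Rightarrow> bool" where
  "isotopic_to_id_rel D f \<longleftrightarrow> (\<exists>H :: real \<Rightarrow> 'c \<Rightarrow> 'c.
     continuous_on ({0..1} \<times> UNIV) (\<lambda>(t, x). H t x) \<and>
     (\<forall>t\<in>{0..1}. (\<exists>K. homeomorphism UNIV UNIV (H t) K) \<and> (\<forall>x\<in>D. H t x = x)) \<and>
     H 0 = id \<and> H 1 = f)"

definition biholomorphic ::
  "'c::topological_space chart set \<Rightarrow> 'c chart set \<Rightarrow> ('c \<Rightarrow> 'c) \<Rightarrow> bool" where
  "biholomorphic A B f \<longleftrightarrow> (\<exists>k. homeomorphism UNIV UNIV f k) \<and>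
     (\<forall>b\<in>A. \<forall>c\<in>B. (snd c \<circ> f \<circ> chart_pt b) holomorphic_on (snd b ` (fst b \<inter> f -` fst c)))"

text \<open>The Teichmueller space of the pointed surface underlying \<open>(A\<^sub>0, D)\<close>: complex structures
  inducing the same orientation as \<open>A\<^sub>0\<close>, up to isotopy fixing each marked point.  Every marked
  pointed Riemann surface is represented by transporting its complex structure along the
  marking.\<close>

definition teichmueller ::
  "'c::topological_space chart set \<Rightarrow> 'c set \<Rightarrow> 'c chart set set set" where
  "teichmueller A\<^sub>0 D =
     {A. complex_structure A \<and> same_orientation A\<^sub>0 A} //
     {(A, B). complex_structure A \<and> same_orientation A\<^sub>0 A \<and>
              complex_structure B \<and> same_orientation A\<^sub>0 B \<and>
              (\<exists>f. isotopic_to_id_rel D f \<and> biholomorphic A B f)}"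


section \<open>The Hitchin map\<close>

text \<open>\<open>p(\<Phi>)\<close> as a meromorphic differential; for invariant \<open>p\<close> the value is the same for all
  representatives \<open>(a, X)\<close> of \<open>\<Phi> c x\<close>.\<close>

definition eval_inv ::
  "'c chart set \<Rightarrow> 'c set \<Rightarrow> ('n::finite cmat \<Rightarrow> complex) \<Rightarrow> ('p, 'c, 'n) higgs_field
     \<Rightarrow> 'c chart \<Rightarrow> 'c \<Rightarrow> complex" where
  "eval_inv A D p \<Phi> c x =
     (if c \<in> A \<and> x \<in> fst c - D then the_elem ((\<lambda>(a, X). p X) ` \<Phi> c x) else 0)"

definition hitchin ::
  "'c chart set \<Rightarrow> 'c set \<Rightarrow> nat \<Rightarrow> (nat \<Rightarrow> 'n::finite cmat \<Rightarrow> complex)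
     \<Rightarrow> ('p, 'c, 'n) pbundle \<times> ('p, 'c, 'n) higgs_field \<Rightarrow> nat \<Rightarrow> 'c chart \<Rightarrow> 'c \<Rightarrow> complex" where
  "hitchin A D l p = (\<lambda>(P, \<Phi>). \<lambda>j\<in>{..<l}. eval_inv A D (p j) \<Phi>)"

definition hitchin_base ::
  "'c::topological_space chart set \<Rightarrow> 'c set \<Rightarrow> nat \<Rightarrow> (nat \<Rightarrow> nat) \<Rightarrow> (nat \<Rightarrow> nat)
     \<Rightarrow> (nat \<Rightarrow> 'c chart \<Rightarrow> 'c \<Rightarrow> complex) set" where
  "hitchin_base A D l d m = (\<Pi>\<^sub>E j\<in>{..<l}. log_differentials A D (d j) (m j))"

text \<open>The Hitchin map on isomorphism classes.\<close>

definition hitchin_map ::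
  "'c chart set \<Rightarrow> 'c set \<Rightarrow> nat \<Rightarrow> (nat \<Rightarrow> 'n::finite cmat \<Rightarrow> complex)
     \<Rightarrow> (('p, 'c, 'n) pbundle \<times> ('p, 'c, 'n) higgs_field) set \<Rightarrow> nat \<Rightarrow> 'c chart \<Rightarrow> 'c \<Rightarrow> complex" where
  "hitchin_map A D l p E = the_elem (hitchin A D l p ` E)"

end

theory Submission
  imports Defs
begin

text \<open>
  The only statement with real content is that an invariant polynomial \<open>p\<close>, homogeneous of
  positive degree \<open>d\<close>, vanishes at every nilpotent \<open>N\<close>; since \<open>p 0 =
  0\<close>, this is the equation \<open>p N = p 0\<close> of \<open>invariant_poly_nilpotent\<close>. Granted
  this, let \<open>X\<close> be the coefficient of the Higgs field in a coordinate \<open>y\<close> centred at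
  a marked point and in a local trivialization. Then \<open>y X\<close> is holomorphic with value the residue
  \<open>N\<close> at the marked point, so that \<open>y\<^sup>d p(X) = p(y X)\<close> is holomorphic and
  vanishes there; dividing once by \<open>y\<close> shows that \<open>p(X)\<close> has a pole of order at most
  \<open>d - 1\<close> (\<open>pole_le_homogeneous\<close>). The rest is the compatibility of \<open>p\<close>
  with changes of chart, of trivialization and of the representative of an isomorphism class.

  The vanishing at nilpotent elements is proved by the method of Kempf and Ness, without the Jacobson-Morozov
  theorem or any root theory. A compact real form preserves a Hermitian metric on the space on which the
  matrices act (\<open>compact_group_invariant_metric\<close>), and the Lie algebra is then closed under the
  adjoint \<open>Y \<mapsto> Y\<^sup>*\<close> of this metric (\<open>reductive_metric\<close>). Let
  \<open>Y\<close> be an element of least norm in the closure of the orbit of \<open>N\<close> under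
  conjugation. The derivative of the norm along the orbit vanishes at \<open>Y\<close>, and this forces
  \<open>[Y, Y\<^sup>*] = 0\<close> (\<open>normal_if_critical\<close>). Being ad-nilpotent is a closed
  condition when the exponent is fixed, so \<open>Y\<close> is ad-nilpotent on the derived algebra; as
  \<open>Y\<close> is normal, this makes it central (\<open>normal_ad_nilpotent_zero\<close>). But
  \<open>Y\<close> lies in the derived algebra, which is orthogonal to the centre, so \<open>Y = 0\<close>
  (\<open>lie_derived_central_zero\<close>). By continuity \<open>p N = p Y = p 0 = 0\<close>.
\<close>

section \<open>Matrix algebra\<close>

lemma matrix_mul_minus_left: "(- A) ** B = - (A ** (B :: 'n::finite cmat))"
  by (simp add: matrix_matrix_mult_def vec_eq_iff sum_negf)

lemma matrix_mul_minus_right: "A ** (- B) = - (A ** (B :: 'n::finite cmat))"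
  by (simp add: matrix_matrix_mult_def vec_eq_iff sum_negf)

lemma matrix_mul_diff_left: "(A - B) ** C = A ** C - B ** (C :: 'n::finite cmat)"
  by (simp add: matrix_matrix_mult_def vec_eq_iff sum_subtractf algebra_simps)

lemma matrix_mul_diff_right: "C ** (A - B) = C ** A - C ** (B :: 'n::finite cmat)"
  by (simp add: matrix_matrix_mult_def vec_eq_iff sum_subtractf algebra_simps)

lemma matrix_mul_add_left: "(A + B) ** C = A ** C + B ** (C :: 'n::finite cmat)"
  by (simp add: matrix_matrix_mult_def vec_eq_iff sum.distrib algebra_simps)

lemma matrix_mul_cscale_left: "cscale c A ** B = cscale c (A ** B)"
  by (simp add: matrix_matrix_mult_def vec_eq_iff cscale_def sum_distrib_left mult_ac)

lemma matrix_mul_cscale_right: "A ** cscale c B = cscale c (A ** B)"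
  by (simp add: matrix_matrix_mult_def vec_eq_iff cscale_def sum_distrib_left mult_ac)

lemma scaleR_eq_cscale: "r *\<^sub>R A = cscale (of_real r) A"
  by (simp add: cscale_def vec_eq_iff flip: scaleR_conv_of_real)

lemmas matrix_ring_simps = matrix_add_ldistrib matrix_mul_add_left
  matrix_mul_diff_left matrix_mul_diff_right matrix_mul_minus_left matrix_mul_minus_right
  matrix_mul_assoc[symmetric]

lemma bounded_bilinear_matrix_mul:
  "bounded_bilinear ((**) :: 'n::finite cmat \<Rightarrow> 'n cmat \<Rightarrow> 'n cmat)"
  unfolding bilinear_conv_bounded_bilinear[symmetric] bilinear_def
  by (auto intro!: linearI simp: matrix_add_ldistrib matrix_mul_add_left scaleR_eq_cscale
      matrix_mul_cscale_left matrix_mul_cscale_right)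

lemmas continuous_on_matrix_mul [continuous_intros] =
  bounded_bilinear.continuous_on[OF bounded_bilinear_matrix_mul]
lemmas tendsto_matrix_mul [tendsto_intros] =
  bounded_bilinear.tendsto[OF bounded_bilinear_matrix_mul]
lemmas has_vector_derivative_matrix_mul =
  bounded_bilinear.has_vector_derivative[OF bounded_bilinear_matrix_mul]

lemma matrix_inv_mul:
  fixes A :: "'n::finite cmat"
  assumes "invertible A"
  shows "A ** matrix_inv A = mat 1" "matrix_inv A ** A = mat 1"
  using assms unfolding invertible_def matrix_inv_def by (metis (mono_tags, lifting) someI_ex)+

lemma matrix_inv_cancel:
  fixes A :: "'n::finite cmat"
  assumes "invertible A"
  shows "A ** (matrix_inv A ** B) = B" "matrix_inv A ** (A ** B) = B"
  by (simp_all add: matrix_mul_assoc matrix_inv_mul[OF assms])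

lemma matrix_inv_unique:
  fixes A B :: "'n::finite cmat"
  assumes "A ** B = mat 1"
  shows "invertible A" "matrix_inv A = B"
proof -
  show inv: "invertible A" using assms matrix_left_right_inverse unfolding invertible_def by metis
  show "matrix_inv A = B"
    using matrix_inv_cancel(2)[OF inv, of B] assms by simp
qed

lemma invertible_matrix_inv:
  fixes A :: "'n::finite cmat"
  shows "invertible A \<Longrightarrow> invertible (matrix_inv A)"
  by (metis matrix_inv_mul(2) matrix_inv_unique(1))

lemma matrix_inv_mat_1: "matrix_inv (mat 1 :: 'n::finite cmat) = mat 1"
  by (rule matrix_inv_unique) simp

lemma matrix_inv_matrix_mul:
  fixes A B :: "'n::finite cmat"
  assumes "invertible A" "invertible B"
  shows "matrix_inv (A ** B) = matrix_inv B ** matrix_inv A"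
  by (rule matrix_inv_unique)
     (simp add: matrix_mul_assoc[symmetric] matrix_inv_cancel assms matrix_inv_mul)

subsection \<open>Conjugate transpose\<close>

text \<open>The conjugate transpose, written \<open>A\<^sup>*\<close> in the comments on metrics.\<close>

definition ctr :: "'n::finite cmat \<Rightarrow> 'n cmat" where
  "ctr A = (\<chi> i j. cnj (A $ j $ i))"

lemma ctr_ctr [simp]: "ctr (ctr A) = A"
  by (simp add: ctr_def vec_eq_iff)

lemma ctr_matrix_mul: "ctr (A ** B) = ctr B ** ctr A"
  by (simp add: ctr_def matrix_matrix_mult_def vec_eq_iff mult.commute)

lemma ctr_add: "ctr (A + B) = ctr A + ctr B"
  by (simp add: ctr_def vec_eq_iff)

lemma ctr_diff: "ctr (A - B) = ctr A - ctr B"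
  by (simp add: ctr_def vec_eq_iff)

lemma ctr_minus: "ctr (- A) = - ctr A"
  by (simp add: ctr_def vec_eq_iff)

lemma ctr_cscale: "ctr (cscale c A) = cscale (cnj c) (ctr A)"
  by (simp add: ctr_def cscale_def vec_eq_iff)

lemma ctr_scaleR: "ctr (r *\<^sub>R A) = r *\<^sub>R ctr A"
  by (simp add: scaleR_eq_cscale ctr_cscale)

lemma ctr_mat_1 [simp]: "ctr (mat 1) = mat 1"
  by (simp add: ctr_def mat_def vec_eq_iff)

lemma linear_ctr: "linear ctr"
  by (rule linearI) (simp_all add: ctr_add ctr_scaleR)

lemmas bounded_linear_ctr = linear_ctr[unfolded linear_conv_bounded_linear]
lemmas continuous_on_ctr [continuous_intros] = bounded_linear.continuous_on[OF bounded_linear_ctr]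

lemma trace_ctr: "trace (ctr A) = cnj (trace A)"
  by (simp add: trace_def ctr_def)

lemma trace_cscale: "trace (cscale c A) = c * trace A"
  by (simp add: trace_def cscale_def sum_distrib_left)

lemma Re_trace_ctr_pos:
  fixes A :: "'n::finite cmat"
  assumes "A \<noteq> 0"
  shows "Re (trace (A ** ctr A)) > 0"
proof -
  have "trace (A ** ctr A) = of_real (\<Sum>i\<in>UNIV. \<Sum>j\<in>UNIV. (cmod (A $ i $ j))\<^sup>2)"
    by (simp only: trace_def matrix_matrix_mult_def ctr_def vec_lambda_beta
        complex_norm_square of_real_sum)
  then have eq: "Re (trace (A ** ctr A)) = (\<Sum>i\<in>UNIV. \<Sum>j\<in>UNIV. (cmod (A $ i $ j))\<^sup>2)"
    by simp
  from assms obtain i j where "A $ i $ j \<noteq> 0"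
    by (auto simp: vec_eq_iff)
  then have "(\<Sum>j\<in>UNIV. (cmod (A $ i $ j))\<^sup>2) > 0"
    by (intro sum_pos2[of UNIV j]) auto
  then show ?thesis unfolding eq
    by - (rule sum_pos2[of UNIV i], auto intro: sum_nonneg)
qed

section \<open>The Lie algebra of a matrix group\<close>

text \<open>A curve in the definition of the Lie algebra need not be continuous away from \<open>0\<close>.  The limit
  of its inverse comes from \<open>\<gamma>\<^sup>-\<^sup>1 - 1 = - \<gamma>\<^sup>-\<^sup>1 (\<gamma> - 1)\<close>, which bounds \<open>\<gamma>\<^sup>-\<^sup>1 - 1\<close> by a multiple of
  \<open>\<gamma> - 1\<close> as soon as \<open>\<gamma> - 1\<close> is small.\<close>

lemma tendsto_matrix_inv_1:
  fixes \<gamma> :: "real \<Rightarrow> 'n::finite cmat"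
  assumes lim: "(\<gamma> \<longlongrightarrow> mat 1) (at 0)" and inv: "\<And>t. invertible (\<gamma> t)"
  shows "((\<lambda>t. matrix_inv (\<gamma> t)) \<longlongrightarrow> mat 1) (at 0)"
proof -
  have "\<exists>K>0. \<forall>(A :: 'n cmat) (B :: 'n cmat). norm (A ** B) \<le> norm A * norm B * K"
    by (rule bounded_bilinear.pos_bounded[OF bounded_bilinear_matrix_mul])
  then obtain K where K: "K > 0" "\<forall>(A :: 'n cmat) (B :: 'n cmat). norm (A ** B) \<le> norm A * norm B * K"
    by blast
  define I where "I = (mat 1 :: 'n cmat)"
  have ev: "\<forall>\<^sub>F t in at 0. norm (\<gamma> t - I) < 1 / (2 * K)"
    using tendstoD[OF lim, of "1 / (2 * K)"] K(1) by (simp add: dist_norm I_def)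
  have bound: "norm (matrix_inv (\<gamma> t) - I) \<le> 2 * K * norm I * norm (\<gamma> t - I)"
    if t: "norm (\<gamma> t - I) < 1 / (2 * K)" for t
  proof -
    define \<delta> where "\<delta> = matrix_inv (\<gamma> t)"
    have "\<delta> - I = - (\<delta> ** (\<gamma> t - I))"
      unfolding \<delta>_def I_def by (simp add: matrix_mul_diff_right matrix_inv_mul inv)
    then have 1: "norm (\<delta> - I) \<le> norm \<delta> * norm (\<gamma> t - I) * K"
      using K(2)[rule_format, of \<delta> "\<gamma> t - I"] by (metis norm_minus_cancel)
    have "norm \<delta> \<le> norm (\<delta> - I) + norm I"
      using norm_triangle_ineq[of "\<delta> - I" I] by simp
    then have "norm \<delta> * (norm (\<gamma> t - I) * K) \<le> (norm (\<delta> - I) + norm I) * (norm (\<gamma> t - I) * K)"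
      using K(1) by (intro mult_right_mono) auto
    moreover have "norm (\<gamma> t - I) * K \<le> 1 / 2"
      using t K(1) by (simp add: field_simps)
    then have "norm (\<delta> - I) * (norm (\<gamma> t - I) * K) \<le> norm (\<delta> - I) * (1/2)"
      by (intro mult_left_mono norm_ge_zero)
    ultimately have "norm (\<delta> - I) \<le> norm (\<delta> - I) * (1/2) + norm I * (norm (\<gamma> t - I) * K)"
      using 1 by (simp only: distrib_right mult.assoc)
    then have "norm (\<delta> - I) \<le> 2 * (norm I * (norm (\<gamma> t - I) * K))"
      by linarith
    then show ?thesis unfolding \<delta>_def by (simp only: mult_ac)
  qed
  have "((\<lambda>t. matrix_inv (\<gamma> t) - I) \<longlongrightarrow> 0) (at 0)"
  proof (rule Lim_null_comparison)
    show "\<forall>\<^sub>F t in at 0. norm (matrix_inv (\<gamma> t) - I) \<le> 2 * K * norm I * norm (\<gamma> t - I)"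
      using ev by eventually_elim (rule bound)
    have "((\<lambda>t. \<gamma> t - I) \<longlongrightarrow> 0) (at 0)"
      using lim by (simp add: I_def LIM_zero)
    then have "((\<lambda>t. norm (\<gamma> t - I)) \<longlongrightarrow> 0) (at 0)" by (rule tendsto_norm_zero)
    from tendsto_mult_left[OF this, of "2 * K * norm I"]
    show "((\<lambda>t. 2 * K * norm I * norm (\<gamma> t - I)) \<longlongrightarrow> 0) (at 0)" by simp
  qed
  then show ?thesis unfolding I_def by (rule LIM_zero_cancel)
qed

lemma has_vector_derivative_at_0_iff:
  fixes f :: "real \<Rightarrow> 'a::real_normed_vector"
  shows "(f has_vector_derivative D) (at 0) \<longleftrightarrow> ((\<lambda>t. (f t - f 0) /\<^sub>R t) \<longlongrightarrow> D) (at 0)"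
proof -
  have eq: "(f t - f 0 - t *\<^sub>R D) /\<^sub>R t = (f t - f 0) /\<^sub>R t - D" if "t \<noteq> 0" for t
    using that by (simp add: algebra_simps)
  have "(f has_vector_derivative D) (at 0) \<longleftrightarrow>
      ((\<lambda>t. norm ((f t - f 0 - t *\<^sub>R D) /\<^sub>R t)) \<longlongrightarrow> 0) (at 0)"
    unfolding has_vector_derivative_def has_derivative_at
    by (simp add: bounded_linear_scaleR_left divide_inverse mult.commute)
  also have "\<dots> \<longleftrightarrow> ((\<lambda>t. norm ((f t - f 0) /\<^sub>R t - D)) \<longlongrightarrow> 0) (at 0)"
    by (rule filterlim_cong) (auto simp: eventually_at_filter eq simp del: norm_scaleR)
  also have "\<dots> \<longleftrightarrow> ((\<lambda>t. (f t - f 0) /\<^sub>R t) \<longlongrightarrow> D) (at 0)"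
    by (simp only: tendsto_norm_zero_iff LIM_zero_iff)
  finally show ?thesis .
qed

lemma has_vector_derivative_matrix_inv_1:
  fixes \<gamma> :: "real \<Rightarrow> 'n::finite cmat"
  assumes \<gamma>: "(\<gamma> has_vector_derivative X) (at 0)" "\<gamma> 0 = mat 1" "\<And>t. invertible (\<gamma> t)"
  shows "((\<lambda>t. matrix_inv (\<gamma> t)) has_vector_derivative - X) (at 0)"
proof -
  have "continuous (at 0) \<gamma>"
    using \<gamma>(1) by (rule has_vector_derivative_continuous)
  then have "(\<gamma> \<longlongrightarrow> mat 1) (at 0)"
    by (simp add: continuous_at \<gamma>(2))
  note lim = tendsto_matrix_inv_1[OF this \<gamma>(3)]
  have "((\<lambda>t. - (matrix_inv (\<gamma> t) ** ((\<gamma> t - \<gamma> 0) /\<^sub>R t))) \<longlongrightarrow> - (mat 1 ** X)) (at 0)"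
    using \<gamma>(1) unfolding has_vector_derivative_at_0_iff by (intro tendsto_intros lim)
  moreover have "- (matrix_inv (\<gamma> t) ** ((\<gamma> t - \<gamma> 0) /\<^sub>R t)) =
      (matrix_inv (\<gamma> t) - matrix_inv (\<gamma> 0)) /\<^sub>R t" for t
    using \<gamma>(3)[of t] by (simp add: \<gamma>(2) matrix_inv_mat_1 matrix_mul_diff_right scaleR_eq_cscale
        matrix_mul_cscale_right matrix_inv_mul cmat.scale_right_diff_distrib)
  ultimately show ?thesis unfolding has_vector_derivative_at_0_iff by simp
qed

lemma matrix_subgroupD:
  assumes "matrix_subgroup G"
  shows "\<And>g. g \<in> G \<Longrightarrow> invertible g" "mat 1 \<in> G"
    "\<And>g h. g \<in> G \<Longrightarrow> h \<in> G \<Longrightarrow> g ** h \<in> G" "\<And>g. g \<in> G \<Longrightarrow> matrix_inv g \<in> G"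
  using assms by (auto simp: matrix_subgroup_def)

lemma lie_algI:
  assumes "\<And>t. \<gamma> t \<in> G" "\<gamma> 0 = mat 1" "(\<gamma> has_vector_derivative X) (at 0)"
  shows "X \<in> lie_alg G"
  using assms by (auto simp: lie_alg_def)

lemma lie_algE:
  assumes "X \<in> lie_alg G"
  obtains \<gamma> where "\<And>t. \<gamma> t \<in> G" "\<gamma> 0 = mat 1" "(\<gamma> has_vector_derivative X) (at 0)"
  using assms by (auto simp: lie_alg_def)

lemma subspace_lie_alg:
  fixes G :: "'n::finite cmat set"
  assumes G: "matrix_subgroup G"
  shows "subspace (lie_alg G)"
proof (rule subspaceI)
  show "0 \<in> lie_alg G"
    by (rule lie_algI[of "\<lambda>_. mat 1"]) (auto simp: matrix_subgroupD[OF G])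
next
  fix X Y assume "X \<in> lie_alg G" "Y \<in> lie_alg G"
  then obtain \<gamma> \<delta> where *: "\<And>t. \<gamma> t \<in> G" "\<gamma> 0 = mat 1" "(\<gamma> has_vector_derivative X) (at 0)"
    "\<And>t. \<delta> t \<in> G" "\<delta> 0 = mat 1" "(\<delta> has_vector_derivative Y) (at 0)"
    by (metis lie_algE)
  show "X + Y \<in> lie_alg G"
    by (rule lie_algI[of "\<lambda>t. \<gamma> t ** \<delta> t"])
      (use * has_vector_derivative_matrix_mul[OF *(3,6)] in
        \<open>auto simp: matrix_subgroupD[OF G] add.commute\<close>)
next
  fix c :: real and X assume "X \<in> lie_alg G"
  then obtain \<gamma> where *: "\<And>t. \<gamma> t \<in> G" "\<gamma> 0 = mat 1" "(\<gamma> has_vector_derivative X) (at 0)"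
    by (metis lie_algE)
  have "((\<gamma> \<circ> (\<lambda>t. c * t)) has_vector_derivative c *\<^sub>R X) (at 0)"
    by (rule vector_diff_chain_at)
      (use *(3) in \<open>auto intro!: derivative_eq_intros simp flip: has_real_derivative_iff_has_vector_derivative\<close>)
  then show "c *\<^sub>R X \<in> lie_alg G"
    by (intro lie_algI[of "\<gamma> \<circ> (\<lambda>t. c * t)"]) (use * in auto)
qed

lemma Ad_mat_1 [simp]: "Ad (mat 1) X = X"
  by (simp add: Ad_def matrix_inv_mat_1)

lemma Ad_Ad:
  assumes "invertible g" "invertible h"
  shows "Ad g (Ad h X) = Ad (g ** h) X"
  using assms by (simp add: Ad_def matrix_inv_matrix_mul matrix_mul_assoc)

lemma Ad_matrix_mul:
  assumes "invertible g"
  shows "Ad g (X ** Y) = Ad g X ** Ad g Y"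
  by (simp add: Ad_def matrix_mul_assoc[symmetric] matrix_inv_cancel assms)

lemma Ad_bracket:
  assumes "invertible g"
  shows "Ad g (bracket X Y) = bracket (Ad g X) (Ad g Y)"
proof -
  have "Ad g (bracket X Y) = Ad g (X ** Y) - Ad g (Y ** X)"
    by (simp add: Ad_def bracket_def matrix_ring_simps)
  then show ?thesis by (simp add: Ad_matrix_mul assms bracket_def)
qed

lemma linear_Ad: "linear (Ad g)"
  by (rule linearI)
    (simp_all add: Ad_def matrix_ring_simps scaleR_eq_cscale matrix_mul_cscale_left matrix_mul_cscale_right)

lemma Ad_cscale: "Ad g (cscale c X) = cscale c (Ad g X)"
  by (simp add: Ad_def matrix_mul_cscale_left matrix_mul_cscale_right)

lemma Ad_inv_cancel:
  assumes "invertible g"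
  shows "Ad g (Ad (matrix_inv g) X) = X"
  by (simp add: Ad_Ad invertible_matrix_inv assms matrix_inv_mul)

lemma Ad_lie_alg:
  assumes G: "matrix_subgroup G" and g: "g \<in> G" and X: "X \<in> lie_alg G"
  shows "Ad g X \<in> lie_alg G"
proof -
  from X obtain \<gamma> where *: "\<And>t. \<gamma> t \<in> G" "\<gamma> 0 = mat 1" "(\<gamma> has_vector_derivative X) (at 0)"
    by (metis lie_algE)
  have "((\<lambda>t. Ad g (\<gamma> t)) has_vector_derivative Ad g X) (at 0)"
    using linear_Ad[of g] *(3) unfolding linear_conv_bounded_linear
    by (rule bounded_linear.has_vector_derivative)
  then show ?thesis
    by (intro lie_algI[of "\<lambda>t. Ad g (\<gamma> t)"])
      (use * in \<open>auto simp: Ad_def g matrix_subgroupD[OF G] matrix_inv_mul\<close>)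
qed

lemma has_vector_derivative_Ad:
  fixes \<gamma> :: "real \<Rightarrow> 'n::finite cmat"
  assumes \<gamma>: "(\<gamma> has_vector_derivative X) (at 0)" "\<gamma> 0 = mat 1" "\<And>t. invertible (\<gamma> t)"
  shows "((\<lambda>t. Ad (\<gamma> t) Y) has_vector_derivative bracket X Y) (at 0)"
proof -
  have "((\<lambda>t. \<gamma> t ** Y) has_vector_derivative X ** Y) (at 0)"
    using has_vector_derivative_matrix_mul[OF \<gamma>(1) has_vector_derivative_const[of Y]] by simp
  from has_vector_derivative_matrix_mul[OF this has_vector_derivative_matrix_inv_1[OF \<gamma>]]
  show ?thesis
    by (simp add: Ad_def bracket_def \<gamma>(2) matrix_inv_mat_1 matrix_ring_simps)
qed

text \<open>The bracket \<open>[X, Y]\<close> is the velocity of the curve \<open>Ad (\<gamma> t) Y\<close>, which stays in the Lie algebra,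
  and the Lie algebra is closed because it is a subspace.\<close>

lemma bracket_lie_alg:
  assumes G: "matrix_subgroup G" and "X \<in> lie_alg G" "Y \<in> lie_alg G"
  shows "bracket X Y \<in> lie_alg G"
proof -
  from assms(2) obtain \<gamma> where *: "\<And>t. \<gamma> t \<in> G" "\<gamma> 0 = mat 1" "(\<gamma> has_vector_derivative X) (at 0)"
    by (metis lie_algE)
  note sub = subspace_lie_alg[OF G]
  have "((\<lambda>t. (Ad (\<gamma> t) Y - Ad (\<gamma> 0) Y) /\<^sub>R t) \<longlongrightarrow> bracket X Y) (at 0)"
    using has_vector_derivative_Ad[OF *(3,2)] *(1) matrix_subgroupD[OF G]
    by (simp add: has_vector_derivative_at_0_iff)
  moreover have "(Ad (\<gamma> t) Y - Ad (\<gamma> 0) Y) /\<^sub>R t \<in> lie_alg G" for t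
    using Ad_lie_alg[OF G *(1) assms(3)] by (intro subspace_scale[OF sub] subspace_diff[OF sub])
  ultimately show ?thesis
    using closed_subspace[OF sub] by (intro Lim_in_closed_set[of _ _ "at (0::real)"]) auto
qed

section \<open>Hermitian metrics\<close>

text \<open>The matrix \<open>h\<close> of a positive definite Hermitian form, with positivity stated for all rows of a
  matrix \<open>W\<close> at once: the trace of \<open>W h W\<^sup>*\<close> is the sum of the values \<open>w h w\<^sup>*\<close> over the rows \<open>w\<close>.\<close>

definition hermitian_metric :: "'n::finite cmat \<Rightarrow> bool" where
  "hermitian_metric h \<longleftrightarrow> ctr h = h \<and> (\<forall>W. W \<noteq> 0 \<longrightarrow> Re (trace (W ** h ** ctr W)) > 0)"

text \<open>The adjoint of \<open>X\<close> with respect to the form with matrix \<open>h\<close>.\<close>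

definition dag :: "'n::finite cmat \<Rightarrow> 'n cmat \<Rightarrow> 'n cmat" where
  "dag h X = matrix_inv h ** ctr X ** h"

text \<open>The real part of the Hermitian inner product on matrices induced by \<open>h\<close>.\<close>

definition ip :: "'n::finite cmat \<Rightarrow> 'n cmat \<Rightarrow> 'n cmat \<Rightarrow> real" where
  "ip h X Y = Re (trace (X ** dag h Y))"

lemma hermitian_metricD:
  assumes "hermitian_metric h"
  shows "ctr h = h" "\<And>W. W \<noteq> 0 \<Longrightarrow> Re (trace (W ** h ** ctr W)) > 0"
  using assms by (auto simp: hermitian_metric_def)

lemma hermitian_metric_invertible:
  fixes h :: "'n::finite cmat"
  assumes h: "hermitian_metric h"
  shows "invertible h"
proof -
  have inj: "x = 0" if "h *v x = 0" for x
  proof (rule ccontr)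
    assume "x \<noteq> 0"
    define W :: "'n cmat" where "W = ctr (\<chi> i j. x $ i)"
    have "W \<noteq> 0" using \<open>x \<noteq> 0\<close> by (auto simp: W_def ctr_def vec_eq_iff)
    moreover have "h ** ctr W = 0"
      using that by (auto simp: W_def vec_eq_iff matrix_matrix_mult_def matrix_vector_mult_def)
    ultimately show False
      using hermitian_metricD(2)[OF h, of W] by (simp add: matrix_mul_assoc[symmetric] trace_def)
  qed
  then obtain B where "B ** h = mat 1"
    using matrix_left_invertible_ker[of h] by auto
  then show ?thesis
    by (meson invertible_def matrix_left_right_inverse)
qed

context
  fixes h :: "'n::finite cmat"
  assumes h: "hermitian_metric h"
begin

lemma ctr_matrix_inv_metric: "ctr (matrix_inv h) = matrix_inv h"
proof -
  have "ctr (h ** matrix_inv h) = mat 1"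
    by (simp add: matrix_inv_mul hermitian_metric_invertible[OF h])
  then have "ctr (matrix_inv h) ** h = mat 1"
    by (simp add: ctr_matrix_mul hermitian_metricD(1)[OF h])
  then show ?thesis
    by (metis matrix_inv_cancel(1) matrix_inv_unique h hermitian_metric_invertible matrix_mul_lid
        matrix_mul_assoc matrix_inv_mul(1) matrix_mul_rid)
qed

lemma dag_dag: "dag h (dag h X) = X"
  by (simp add: dag_def ctr_matrix_mul ctr_matrix_inv_metric hermitian_metricD(1)[OF h]
      matrix_mul_assoc[symmetric] matrix_inv_cancel matrix_inv_mul hermitian_metric_invertible[OF h])

lemma dag_matrix_mul: "dag h (X ** Y) = dag h Y ** dag h X"
  by (simp add: dag_def ctr_matrix_mul matrix_mul_assoc[symmetric] matrix_inv_cancel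
      hermitian_metric_invertible[OF h])

lemma dag_diff: "dag h (X - Y) = dag h X - dag h Y"
  by (simp add: dag_def ctr_diff matrix_ring_simps)

lemma dag_add: "dag h (X + Y) = dag h X + dag h Y"
  by (simp add: dag_def ctr_add matrix_ring_simps)

lemma dag_cscale: "dag h (cscale c X) = cscale (cnj c) (dag h X)"
  by (simp add: dag_def ctr_cscale matrix_mul_cscale_left matrix_mul_cscale_right)

lemma dag_bracket: "dag h (bracket X Y) = bracket (dag h Y) (dag h X)"
  by (simp add: bracket_def dag_diff dag_matrix_mul)

lemma trace_dag: "trace (dag h X) = cnj (trace X)"
proof -
  have "trace (dag h X) = trace (h ** (matrix_inv h ** ctr X))"
    unfolding dag_def by (rule trace_mul_sym)
  then show ?thesis
    by (simp add: matrix_inv_cancel hermitian_metric_invertible[OF h] trace_ctr)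
qed

lemma ip_sym: "ip h X Y = ip h Y X"
proof -
  have "trace (dag h (X ** dag h Y)) = cnj (trace (X ** dag h Y))" by (rule trace_dag)
  then show ?thesis by (simp add: ip_def dag_matrix_mul dag_dag)
qed

lemma bracket_adjoint: "ip h (bracket Y Z) W = ip h Z (bracket (dag h Y) W)"
proof -
  have "trace (Z ** (Y ** V)) = trace (Z ** Y ** V)" for V by (simp add: matrix_mul_assoc)
  moreover have "trace (Z ** (V ** Y)) = trace (Y ** Z ** V)" for V
    by (metis matrix_mul_assoc trace_mul_sym)
  ultimately show ?thesis
    by (simp add: ip_def dag_bracket dag_dag)
       (simp add: bracket_def matrix_mul_diff_left matrix_mul_diff_right trace_sub)
qed

end

text \<open>The form \<open>ip h\<close> is positive definite when \<open>h\<close> is a convex combination of matrices \<open>k\<^sup>* k\<close>: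
  for \<open>X = W h\<close> the form equals \<open>tr (W h W\<^sup>* h)\<close>, and replacing the last factor by \<open>k\<^sup>* k\<close>
  gives \<open>tr ((k W) h (k W)\<^sup>*)\<close>.  This makes a square root of \<open>h\<close> unnecessary.\<close>

lemma ip_pos:
  fixes h :: "'n::finite cmat"
  assumes h: "hermitian_metric h"
    and S: "h \<in> convex hull {ctr k ** k | k. invertible k}" and X: "X \<noteq> 0"
  shows "ip h X X > 0"
proof -
  define W where "W = X ** matrix_inv h"
  note inv = hermitian_metric_invertible[OF h]
  have XW: "X = W ** h" by (simp add: W_def matrix_mul_assoc[symmetric] matrix_inv_mul inv)
  have W: "W \<noteq> 0" using X XW by auto
  define T where "T = {h'. Re (trace (W ** h ** ctr W ** h')) > 0}"
  have lin: "linear (\<lambda>h'. Re (trace (W ** h ** ctr W ** h')))"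
    by (rule linearI) (simp_all add: matrix_add_ldistrib trace_add scaleR_eq_cscale
        matrix_mul_cscale_right trace_cscale)
  have "T = (\<lambda>h'. Re (trace (W ** h ** ctr W ** h'))) -` {0<..}"
    by (auto simp: T_def)
  then have "convex T" using convex_linear_vimage[OF lin, of "{0<..}"] by simp
  moreover have "ctr k ** k \<in> T" if "invertible k" for k
  proof -
    have "W ** h ** ctr W ** (ctr k ** k) = (W ** h ** ctr W ** ctr k) ** k"
      by (simp add: matrix_mul_assoc)
    then have "trace (W ** h ** ctr W ** (ctr k ** k)) = trace (k ** (W ** h ** ctr W ** ctr k))"
      by (metis trace_mul_sym)
    also have "k ** (W ** h ** ctr W ** ctr k) = (k ** W) ** h ** ctr (k ** W)"
      by (simp add: ctr_matrix_mul matrix_mul_assoc)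
    finally have "trace (W ** h ** ctr W ** (ctr k ** k)) = trace ((k ** W) ** h ** ctr (k ** W))" .
    moreover have "k ** W \<noteq> 0" using W that by (metis matrix_inv_cancel(2) times0_right)
    ultimately show ?thesis using hermitian_metricD(2)[OF h, of "k ** W"] by (simp add: T_def)
  qed
  ultimately have "convex hull {ctr k ** k | k. invertible k} \<subseteq> T"
    by (intro hull_minimal) auto
  then have "h \<in> T" using S by blast
  moreover have "X ** dag h X = W ** h ** ctr W ** h"
    by (simp add: XW dag_def ctr_matrix_mul hermitian_metricD(1)[OF h] matrix_mul_assoc[symmetric]
        matrix_inv_cancel inv)
  ultimately show ?thesis by (simp add: T_def ip_def)
qed

section \<open>Compact groups preserve a Hermitian metric\<close>

lemma norm_midpoint_less:
  fixes a b :: "'a::real_inner"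
  assumes "norm a \<le> m" "norm b \<le> m" "a \<noteq> b"
  shows "norm ((1/2) *\<^sub>R (a + b)) < m"
proof -
  have m: "m \<ge> 0" using assms(1) norm_ge_zero order_trans by blast
  have "norm (a + b) ^ 2 + norm (a - b) ^ 2 = 2 * norm a ^ 2 + 2 * norm b ^ 2"
    by (simp add: power2_norm_eq_inner algebra_simps inner_commute)
  moreover have "norm a ^ 2 \<le> m ^ 2" "norm b ^ 2 \<le> m ^ 2"
    using assms by (auto intro: power_mono)
  moreover have "norm (a - b) ^ 2 > 0" using assms by simp
  moreover have "(2 * m) ^ 2 = 4 * m ^ 2" by (simp add: power_mult_distrib)
  ultimately have "norm (a + b) ^ 2 < (2 * m) ^ 2" by linarith
  then have "norm (a + b) < 2 * m" using m by (metis power2_less_imp_less mult_nonneg_nonneg zero_le_numeral)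
  then show ?thesis by simp
qed

text \<open>The metric is a fixed point of the action \<open>H \<mapsto> k\<^sup>* H k\<close> on the convex hull of the forms
  \<open>k\<^sup>* k\<close>.  The largest norm in the orbit of \<open>H\<close> is an invariant function of \<open>H\<close>, and by
  the parallelogram law it has only one minimizer on a compact convex set.\<close>

lemma compact_group_invariant_metric:
  fixes K :: "'n::finite cmat set"
  assumes K: "matrix_subgroup K" "compact K"
  obtains h where "hermitian_metric h" "h \<in> convex hull {ctr k ** k | k. invertible k}"
    "\<And>k. k \<in> K \<Longrightarrow> ctr k ** h ** k = h"
proof -
  define S where "S = convex hull ((\<lambda>k. ctr k ** k) ` K)"
  define congr where "congr k H = ctr k ** H ** k" for k H :: "'n cmat"
  define \<phi> where "\<phi> H = (SUP k\<in>K. norm (congr k H))" for H :: "'n cmat"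
  note grp = matrix_subgroupD[OF K(1)]
  have K0: "K \<noteq> {}" using grp(2) by auto
  have linear_congr: "linear (congr k)" for k
    by (rule linearI) (simp_all add: congr_def matrix_ring_simps scaleR_eq_cscale
        matrix_mul_cscale_left matrix_mul_cscale_right)
  have congr_congr: "congr k (congr k' H) = congr (k' ** k) H" for k k' H
    by (simp add: congr_def ctr_matrix_mul matrix_mul_assoc)
  have continuous_congr: "continuous_on A (\<lambda>k. norm (congr k H))" for A H
    unfolding congr_def by (intro continuous_intros)
  have "compact S"
    unfolding S_def by (intro compact_convex_hull compact_continuous_image continuous_intros K)
  have "S \<noteq> {}" using K0 by (simp add: S_def)
  have attained: "\<exists>k\<in>K. \<phi> H = norm (congr k H) \<and> (\<forall>k'\<in>K. norm (congr k' H) \<le> norm (congr k H))" for H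
  proof -
    obtain k where k: "k \<in> K" "\<forall>k'\<in>K. norm (congr k' H) \<le> norm (congr k H)"
      using continuous_attains_sup[OF K(2) K0 continuous_congr] by blast
    then have "\<phi> H = norm (congr k H)"
      unfolding \<phi>_def by (intro cSup_eq_maximum) auto
    with k show ?thesis by blast
  qed
  have le_\<phi>: "norm (congr k H) \<le> \<phi> H" if "k \<in> K" for k H
    using attained[of H] that by auto
  have \<phi>_congr: "\<phi> (congr k H) \<le> \<phi> H" if "k \<in> K" for k H
  proof -
    obtain k' where "k' \<in> K" "\<phi> (congr k H) = norm (congr k' (congr k H))"
      using attained by blast
    then show ?thesis using le_\<phi>[of "k ** k'" H] that grp(3) by (simp add: congr_congr)
  qed
  \<comment> \<open>The set \<open>K\<close> is bounded, so that \<open>\<phi>\<close> is Lipschitz continuous.\<close>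
  obtain C where C: "C \<ge> 0" "\<And>k H. k \<in> K \<Longrightarrow> norm (congr k H) \<le> C * norm H"
  proof -
    have "\<exists>B>0. \<forall>(X :: 'n cmat) (Y :: 'n cmat). norm (X ** Y) \<le> norm X * norm Y * B"
      by (rule bounded_bilinear.pos_bounded[OF bounded_bilinear_matrix_mul])
    then obtain B where B: "B > 0" "\<And>X Y :: 'n cmat. norm ((X :: 'n cmat) ** Y) \<le> norm X * norm Y * B"
      by blast
    obtain a where a: "\<And>k. k \<in> K \<Longrightarrow> norm k \<le> a"
      using compact_imp_bounded[OF K(2)] unfolding bounded_iff by blast
    have "compact (ctr ` K)" by (intro compact_continuous_image continuous_intros K)
    from compact_imp_bounded[OF this] obtain b where b: "\<And>k. k \<in> K \<Longrightarrow> norm (ctr k) \<le> b"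
      unfolding bounded_iff by blast
    have ab: "a \<ge> 0" "b \<ge> 0"
      by (rule order_trans[OF norm_ge_zero a[OF grp(2)]], rule order_trans[OF norm_ge_zero b[OF grp(2)]])
    show thesis
    proof (rule that[of "b * B * a * B"])
      show "0 \<le> b * B * a * B" using ab B(1) by simp
      fix k H assume k: "k \<in> K"
      have "norm (congr k H) \<le> norm (ctr k ** H) * norm k * B"
        unfolding congr_def by (rule B(2))
      also have "\<dots> \<le> (norm (ctr k) * norm H * B) * a * B"
        by (intro mult_mono B(2) a[OF k]) (use ab B(1) in auto)
      also have "\<dots> \<le> (b * norm H * B) * a * B"
        using b[OF k] ab B(1) by (intro mult_right_mono) auto
      finally show "norm (congr k H) \<le> b * B * a * B * norm H" by (simp add: mult_ac)
    qed
  qed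
  have lip: "\<phi> H \<le> \<phi> H' + C * norm (H - H')" for H H'
  proof -
    obtain k where k: "k \<in> K" "\<phi> H = norm (congr k H)" using attained by blast
    have "congr k H = congr k H' + congr k (H - H')"
      using linear_add[OF linear_congr, of k H' "H - H'"] by simp
    then have "\<phi> H \<le> norm (congr k H') + norm (congr k (H - H'))"
      using k(2) norm_triangle_ineq by metis
    also have "\<dots> \<le> \<phi> H' + C * norm (H - H')"
      by (intro add_mono le_\<phi> C k)
    finally show ?thesis .
  qed
  have "C-lipschitz_on UNIV \<phi>"
  proof (rule lipschitz_onI[OF _ C(1)])
    fix H H'
    show "dist (\<phi> H) (\<phi> H') \<le> C * dist H H'"
      using lip[of H H'] lip[of H' H] by (simp add: dist_norm norm_minus_commute)
  qed
  then have "continuous_on S \<phi>"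
    using lipschitz_on_continuous_on continuous_on_subset by blast
  then obtain h where h: "h \<in> S" "\<And>H. H \<in> S \<Longrightarrow> \<phi> h \<le> \<phi> H"
    using continuous_attains_inf[OF \<open>compact S\<close> \<open>S \<noteq> {}\<close>] by blast
  have "convex S" by (simp add: S_def)
  \<comment> \<open>At the midpoint of two distinct minimizers the value would be smaller.\<close>
  have unique: "H = h" if H: "H \<in> S" "\<phi> H \<le> \<phi> h" for H
  proof (rule ccontr)
    assume "H \<noteq> h"
    define M where "M = (1/2) *\<^sub>R (H + h)"
    have "M \<in> S" using convexD[OF \<open>convex S\<close> H(1) h(1), of "1/2" "1/2"]
      by (simp add: M_def scaleR_right_distrib)
    obtain k where k: "k \<in> K" "\<phi> M = norm (congr k M)" using attained by blast
    have "congr (matrix_inv k) (congr k X) = X" for X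
      using grp(1)[OF k(1)] by (simp add: congr_congr matrix_inv_mul) (simp add: congr_def)
    then have "congr k H \<noteq> congr k h" using \<open>H \<noteq> h\<close> by metis
    moreover have "congr k M = (1/2) *\<^sub>R (congr k H + congr k h)"
      unfolding M_def by (simp add: linear_add[OF linear_congr] linear_cmul[OF linear_congr])
    ultimately have "\<phi> M < \<phi> h"
      using k norm_midpoint_less[of "congr k H" "\<phi> h" "congr k h"] le_\<phi>[OF k(1), of H] H(2)
        le_\<phi>[OF k(1), of h] by simp
    with h(2)[OF \<open>M \<in> S\<close>] show False by simp
  qed
  have congr_S: "congr k H \<in> S" if "k \<in> K" "H \<in> S" for k H
  proof -
    have "congr k ` S = convex hull (congr k ` (\<lambda>k. ctr k ** k) ` K)"
      unfolding S_def by (rule convex_hull_linear_image[OF linear_congr])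
    also have "\<dots> \<subseteq> S" unfolding S_def
    proof (rule hull_mono)
      have "congr k (ctr k' ** k') = ctr (k' ** k) ** (k' ** k)" for k'
        by (simp add: congr_def ctr_matrix_mul matrix_mul_assoc)
      then show "congr k ` (\<lambda>k. ctr k ** k) ` K \<subseteq> (\<lambda>k. ctr k ** k) ` K"
        using grp(3) that by auto
    qed
    finally show ?thesis using that by blast
  qed
  show thesis
  proof (rule that)
    show "ctr k ** h ** k = h" if "k \<in> K" for k
      using unique[OF congr_S[OF that h(1)] \<phi>_congr[OF that]] by (simp add: congr_def)
    have "S \<subseteq> convex hull {ctr k ** k | k. invertible k}"
      unfolding S_def using grp(1) by (intro hull_mono) auto
    with h(1) show hull: "h \<in> convex hull {ctr k ** k | k. invertible k}" by blast
    show "hermitian_metric h"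
      unfolding hermitian_metric_def
    proof (intro conjI allI impI)
      have "convex {H. ctr H = H}"
        by (auto simp: convex_def ctr_add ctr_scaleR)
      then have "convex hull {ctr k ** k | k. invertible k} \<subseteq> {H. ctr H = H}"
        by (intro hull_minimal) (auto simp: ctr_matrix_mul)
      with hull show "ctr h = h" by blast
    next
      fix W :: "'n cmat" assume W: "W \<noteq> 0"
      have lin: "linear (\<lambda>h'. Re (trace (W ** h' ** ctr W)))"
        by (rule linearI) (simp_all add: matrix_ring_simps trace_add scaleR_eq_cscale
            matrix_mul_cscale_right matrix_mul_cscale_left trace_cscale)
      define T where "T = (\<lambda>h'. Re (trace (W ** h' ** ctr W))) -` {0<..}"
      have "convex T" unfolding T_def by (rule convex_linear_vimage[OF lin]) simp
      moreover have "ctr k ** k \<in> T" if "invertible k" for k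
      proof -
        have "invertible (ctr k)"
          by (rule matrix_inv_unique(1)[of _ "ctr (matrix_inv k)"])
            (simp add: ctr_matrix_mul[symmetric] matrix_inv_mul that)
        then have "W ** ctr k \<noteq> 0"
          using W by (metis matrix_inv_mul(1) matrix_mul_assoc matrix_mul_rid times0_left)
        moreover have "W ** (ctr k ** k) ** ctr W = (W ** ctr k) ** ctr (W ** ctr k)"
          by (simp add: ctr_matrix_mul matrix_mul_assoc)
        ultimately show ?thesis
          using Re_trace_ctr_pos[of "W ** ctr k"] by (simp add: T_def)
      qed
      ultimately have "convex hull {ctr k ** k | k. invertible k} \<subseteq> T"
        by (intro hull_minimal) auto
      with hull show "Re (trace (W ** h ** ctr W)) > 0" by (auto simp: T_def)
    qed
  qed
qed

section \<open>Invariant polynomials vanish on nilpotent elements\<close>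

lemma bracket_swap: "bracket X Y = - bracket Y (X :: 'n::finite cmat)"
  by (simp add: bracket_def)

lemma bracket_jacobi:
  "bracket X (bracket Y Z) = bracket (bracket X Y) Z + bracket Y (bracket X (Z :: 'n::finite cmat))"
  by (simp add: bracket_def matrix_ring_simps)

lemma bracket_0 [simp]: "bracket X 0 = 0" "bracket 0 X = 0"
  by (simp_all add: bracket_def)

lemma ip_minus: "ip h (- X) Y = - ip h X Y" "ip h X (- Y) = - ip h X Y"
  by (simp_all add: ip_def dag_def ctr_minus matrix_ring_simps trace_def sum_negf)

lemma ip_0 [simp]: "ip h 0 Y = 0" "ip h X 0 = 0"
  using ip_minus[of h 0 Y] ip_minus[of h X 0] by simp_all

lemma bounded_bilinear_ip: "bounded_bilinear (ip h)"
  unfolding bilinear_conv_bounded_bilinear[symmetric] bilinear_def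
  by (auto intro!: linearI simp: ip_def dag_def ctr_add ctr_scaleR matrix_ring_simps scaleR_eq_cscale
      ctr_cscale matrix_mul_cscale_left matrix_mul_cscale_right trace_cscale trace_add)

context
  fixes h :: "'n::finite cmat"
  assumes h: "hermitian_metric h" and pos: "\<And>X. X \<noteq> 0 \<Longrightarrow> ip h X X > 0"
begin

lemma ip_eq_0_iff: "ip h X X = 0 \<longleftrightarrow> X = 0"
  using pos[of X] by fastforce

text \<open>In the comments of this section \<open>Y\<^sup>*\<close> denotes the adjoint \<open>dag h
  Y\<close>. For \<open>H = [Y, Y\<^sup>*]\<close> the inner product of \<open>[H, Y]\<close> and
  \<open>Y\<close>, half the derivative of the squared norm along the orbit of \<open>Y\<close> in the
  direction of \<open>H\<close>, is the squared norm of \<open>H\<close>.\<close>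

lemma normal_if_critical:
  assumes "ip h (bracket (bracket Y (dag h Y)) Y) Y = 0"
  shows "bracket Y (dag h Y) = 0"
proof -
  define H where "H = bracket Y (dag h Y)"
  have "0 = - ip h (bracket Y H) Y"
    using assms by (simp add: H_def[symmetric] bracket_swap[of H] ip_minus)
  also have "\<dots> = - ip h H (bracket (dag h Y) Y)"
    by (simp add: bracket_adjoint[OF h])
  also have "\<dots> = ip h H H"
    by (simp add: bracket_swap[of "dag h Y"] H_def ip_minus)
  finally show ?thesis by (simp add: H_def ip_eq_0_iff)
qed

text \<open>For normal \<open>Y\<close> the operators \<open>ad Y\<close> and \<open>ad Y\<^sup>*\<close> commute and are adjoint to each other, so
  that they have the same kernel.\<close>

lemma normal_ad_square_zero:
  assumes normal: "bracket Y (dag h Y) = 0" and "bracket Y (bracket Y X) = 0"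
  shows "bracket Y X = 0"
proof -
  have comm: "bracket (dag h Y) (bracket Y Z) = bracket Y (bracket (dag h Y) Z)" for Z
    using bracket_jacobi[of "dag h Y" Y Z] normal bracket_swap[of "dag h Y" Y] by simp
  have eq: "ip h (bracket Y Z) (bracket Y Z) = ip h (bracket (dag h Y) Z) (bracket (dag h Y) Z)" for Z
    by (simp add: bracket_adjoint[OF h] dag_dag[OF h] comm)
  have "bracket (dag h Y) (bracket Y X) = 0"
    using eq[of "bracket Y X"] assms(2) by (simp add: ip_eq_0_iff)
  then have "ip h (bracket Y X) (bracket Y X) = 0"
    by (simp add: bracket_adjoint[OF h])
  then show ?thesis by (simp add: ip_eq_0_iff)
qed

lemma normal_ad_nilpotent_zero:
  assumes "bracket Y (dag h Y) = 0" "(bracket Y ^^ Suc k) X = 0"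
  shows "bracket Y X = 0"
  using assms(2)
proof (induction k)
  case (Suc k)
  have "(bracket Y ^^ Suc k) X = 0"
    using normal_ad_square_zero[OF assms(1), of "(bracket Y ^^ k) X"] Suc.prems by simp
  then show ?case by (rule Suc.IH)
qed simp

text \<open>The derived algebra is orthogonal to the centre: \<open>tr ([A, B] Y\<^sup>*) = tr (A [B, Y\<^sup>*])\<close>, and
  \<open>[B, Y\<^sup>*]\<close> is the adjoint of \<open>[Y, B\<^sup>*] = 0\<close>.\<close>

lemma lie_derived_central_zero:
  assumes Y: "Y \<in> lie_derived \<gg>" and central: "\<And>B. B \<in> \<gg> \<Longrightarrow> bracket Y B = 0"
    and dag: "\<And>B. B \<in> \<gg> \<Longrightarrow> dag h B \<in> \<gg>"
  shows "Y = 0"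
proof -
  define T where "T = {W. trace (W ** dag h Y) = 0}"
  have "cmat.subspace T"
    by (rule cmat.subspaceI)
      (simp_all add: T_def matrix_mul_add_left trace_add matrix_mul_cscale_left trace_cscale
        trace_0[unfolded mat_0])
  moreover have "bracket A B \<in> T" if "A \<in> \<gg>" "B \<in> \<gg>" for A B
  proof -
    have "bracket Y (dag h B) = 0" using central dag that by blast
    then have "dag h (bracket Y (dag h B)) = 0" by (simp add: dag_def ctr_def vec_eq_iff zero_vec_def[symmetric])
    then have "bracket B (dag h Y) = 0" by (simp add: dag_bracket[OF h] dag_dag[OF h])
    then have BY: "B ** dag h Y = dag h Y ** B" by (simp add: bracket_def)
    have "trace (B ** A ** dag h Y) = trace (A ** (dag h Y ** B))"
      by (metis matrix_mul_assoc trace_mul_sym)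
    also have "\<dots> = trace (A ** B ** dag h Y)"
      by (simp add: BY[symmetric] matrix_mul_assoc)
    finally show ?thesis by (simp add: T_def bracket_def matrix_mul_diff_left trace_sub)
  qed
  ultimately have "lie_derived \<gg> \<subseteq> T"
    unfolding lie_derived_def by (intro cmat.span_minimal) auto
  with Y show ?thesis
    using ip_eq_0_iff[of Y] by (auto simp: T_def ip_def)
qed

lemma ip_coercive:
  obtains c where "c > 0" "\<And>X. c * norm X ^ 2 \<le> ip h X X"
proof -
  have cont: "continuous_on A (\<lambda>X. ip h X X)" for A
    by (intro bounded_bilinear.continuous_on[OF bounded_bilinear_ip] continuous_intros)
  have "sphere (0 :: 'n cmat) 1 \<noteq> {}" by simp
  then obtain X0 where X0: "X0 \<in> sphere 0 1" "\<And>X. X \<in> sphere 0 1 \<Longrightarrow> ip h X0 X0 \<le> ip h X X"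
    using continuous_attains_inf[OF compact_sphere _ cont] by blast
  show thesis
  proof (rule that)
    show "ip h X0 X0 > 0" using X0(1) pos[of X0] by (cases "X0 = 0") auto
    fix X
    show "ip h X0 X0 * norm X ^ 2 \<le> ip h X X"
    proof (cases "X = 0")
      case False
      interpret ip: bounded_bilinear "ip h" by (rule bounded_bilinear_ip)
      have "ip h X0 X0 \<le> ip h ((1 / norm X) *\<^sub>R X) ((1 / norm X) *\<^sub>R X)"
        by (rule X0) (use False in simp)
      also have "\<dots> = ip h X X / norm X ^ 2"
        by (simp add: ip.scaleR_left ip.scaleR_right power2_eq_square)
      finally show ?thesis using False by (simp add: field_simps)
    qed simp
  qed
qed

end

lemma cpoly_continuous: "cpoly F \<Longrightarrow> continuous_on A F"
  by (induction rule: cpoly.induct) (auto intro!: continuous_intros)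

lemma subspace_if_cmat_subspace: "cmat.subspace V \<Longrightarrow> subspace V"
  by (rule subspaceI)
    (auto simp: cmat.subspace_0 cmat.subspace_add cmat.subspace_scale scaleR_eq_cscale)

lemma lie_derived_closed: "closed (lie_derived \<gg>)"
  unfolding lie_derived_def by (intro closed_subspace subspace_if_cmat_subspace cmat.subspace_span)

lemma bracket_lie_derived: "X \<in> \<gg> \<Longrightarrow> Y \<in> \<gg> \<Longrightarrow> bracket X Y \<in> lie_derived \<gg>"
  unfolding lie_derived_def by (rule cmat.span_base) auto

lemma Ad_lie_derived:
  assumes G: "matrix_subgroup G" and g: "g \<in> G" and X: "X \<in> lie_derived (lie_alg G)"
  shows "Ad g X \<in> lie_derived (lie_alg G)"
proof -
  define T where "T = {X. Ad g X \<in> lie_derived (lie_alg G)}"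
  have sub: "cmat.subspace (lie_derived (lie_alg G))"
    unfolding lie_derived_def by (rule cmat.subspace_span)
  have "cmat.subspace T"
    by (rule cmat.subspaceI)
      (auto simp: T_def linear_0[OF linear_Ad] linear_add[OF linear_Ad] Ad_cscale
        cmat.subspace_0[OF sub] cmat.subspace_add[OF sub] cmat.subspace_scale[OF sub])
  moreover have "bracket X Y \<in> T" if "X \<in> lie_alg G" "Y \<in> lie_alg G" for X Y
    using that G g by (auto simp: T_def Ad_bracket matrix_subgroupD intro: bracket_lie_derived Ad_lie_alg)
  ultimately have "lie_derived (lie_alg G) \<subseteq> T"
    unfolding lie_derived_def by (intro cmat.span_minimal) auto
  with X show ?thesis by (auto simp: T_def)
qed

text \<open>The Lie algebra of the compact real form consists of skew-adjoint matrices for an invariant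
  metric, so that its complexification is closed under taking adjoints.\<close>

lemma reductive_metric:
  fixes G :: "'n::finite cmat set"
  assumes "connected_complex_reductive G"
  obtains h where "hermitian_metric h" "\<And>X. X \<noteq> 0 \<Longrightarrow> ip h X X > 0"
    "\<And>X. X \<in> lie_alg G \<Longrightarrow> dag h X \<in> lie_alg G"
    "cmat.subspace (lie_alg G)"
proof -
  from assms obtain K where G: "matrix_subgroup G" and K: "matrix_subgroup K" "compact K"
    and gK: "lie_alg G = {X + cscale \<i> Y | X Y. X \<in> lie_alg K \<and> Y \<in> lie_alg K}"
    unfolding connected_complex_reductive_def by blast
  obtain h where h: "hermitian_metric h" and hull: "h \<in> convex hull {ctr k ** k | k. invertible k}"
    and inv: "\<And>k. k \<in> K \<Longrightarrow> ctr k ** h ** k = h"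
    using compact_group_invariant_metric[OF K] by blast
  note subK = subspace_lie_alg[OF K(1)]
  have skew: "dag h X = - X" if "X \<in> lie_alg K" for X
  proof -
    from that obtain \<gamma> where *: "\<And>t. \<gamma> t \<in> K" "\<gamma> 0 = mat 1" "(\<gamma> has_vector_derivative X) (at 0)"
      by (metis lie_algE)
    have "((\<lambda>t. ctr (\<gamma> t) ** h) has_vector_derivative ctr X ** h) (at 0)"
      using has_vector_derivative_matrix_mul[OF
          bounded_linear.has_vector_derivative[OF bounded_linear_ctr *(3)]
          has_vector_derivative_const[of h]] by simp
    from has_vector_derivative_matrix_mul[OF this *(3)]
    have "((\<lambda>t. h) has_vector_derivative h ** X + ctr X ** h) (at 0)"
      by (simp add: inv * )
    then have "h ** X + ctr X ** h = 0"
      by (rule vector_derivative_unique_at) (rule has_vector_derivative_const)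
    then have "ctr X ** h = - (h ** X)" by (simp add: eq_neg_iff_add_eq_0 add.commute)
    then have "matrix_inv h ** (ctr X ** h) = - X"
      by (simp add: matrix_mul_minus_right matrix_inv_cancel hermitian_metric_invertible[OF h])
    then show ?thesis by (simp add: dag_def matrix_mul_assoc)
  qed
  have mem: "X + cscale \<i> Y \<in> lie_alg G" if "X \<in> lie_alg K" "Y \<in> lie_alg K" for X Y
    using that gK by blast
  have dag: "dag h Z \<in> lie_alg G" if "Z \<in> lie_alg G" for Z
  proof -
    from that gK obtain X Y where XY: "X \<in> lie_alg K" "Y \<in> lie_alg K" "Z = X + cscale \<i> Y" by blast
    have "dag h Z = - X + cscale \<i> Y"
      by (simp add: XY dag_add[OF h] dag_cscale[OF h] skew)
    then show ?thesis using mem[of "- X" Y] subspace_neg[OF subK] XY by simp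
  qed
  have i: "cscale \<i> Z \<in> lie_alg G" if "Z \<in> lie_alg G" for Z
  proof -
    from that gK obtain X Y where XY: "X \<in> lie_alg K" "Y \<in> lie_alg K" "Z = X + cscale \<i> Y" by blast
    have "cscale \<i> Z = - Y + cscale \<i> X"
      by (simp add: XY cmat.scale_right_distrib)
    then show ?thesis using mem[of "- Y" X] subspace_neg[OF subK] XY by simp
  qed
  note subG = subspace_lie_alg[OF G]
  have "cmat.subspace (lie_alg G)"
  proof (rule cmat.subspaceI)
    fix c Z assume Z: "Z \<in> lie_alg G"
    have "cscale c Z = Re c *\<^sub>R Z + Im c *\<^sub>R cscale \<i> Z"
      by (simp add: scaleR_eq_cscale cmat.scale_left_distrib[symmetric])
         (simp add: complex_eq[symmetric] mult.commute)
    then show "cscale c Z \<in> lie_alg G"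
      using subspace_add[OF subG] subspace_scale[OF subG] i Z by simp
  qed (auto simp: subspace_0[OF subG] subspace_add[OF subG])
  with that[OF h ip_pos[OF h hull] dag] show thesis by blast
qed

text \<open>An element of least norm in the closure of the adjoint orbit of \<open>N\<close> is normal and, like
  \<open>N\<close>, ad-nilpotent; hence it is central, and it is zero because it lies in the derived algebra.
  An invariant polynomial takes the same value there as at \<open>N\<close>.\<close>

lemma invariant_poly_nilpotent:
  fixes G :: "'n::finite cmat set"
  assumes G: "connected_complex_reductive G" and p: "invariant_poly G p"
    and N: "lie_nilpotent (lie_alg G) N"
  shows "p N = p 0" "N \<in> lie_alg G"
proof -
  obtain h where h: "hermitian_metric h" and pos: "\<And>X. X \<noteq> 0 \<Longrightarrow> ip h X X > 0"
    and dag: "\<And>X. X \<in> lie_alg G \<Longrightarrow> dag h X \<in> lie_alg G"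
    and sub: "cmat.subspace (lie_alg G)"
    using reductive_metric[OF G] by blast
  have grp: "matrix_subgroup G" using G by (simp add: connected_complex_reductive_def)
  note grpD = matrix_subgroupD[OF grp]
  have der_sub: "lie_derived (lie_alg G) \<subseteq> lie_alg G"
    unfolding lie_derived_def by (intro cmat.span_minimal sub) (auto intro: bracket_lie_alg[OF grp])
  obtain k where Nder: "N \<in> lie_derived (lie_alg G)"
    and nil: "\<And>Y. Y \<in> lie_derived (lie_alg G) \<Longrightarrow> (bracket N ^^ k) Y = 0"
    using N unfolding lie_nilpotent_def by (metis add_0)
  then show N_mem: "N \<in> lie_alg G" using der_sub by blast
  obtain F where F: "cpoly F" "\<And>X. X \<in> lie_alg G \<Longrightarrow> p X = F X"
    and inv: "\<And>g X. g \<in> G \<Longrightarrow> X \<in> lie_alg G \<Longrightarrow> p (Ad g X) = p X"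
    using p unfolding invariant_poly_def by blast
  define S where "S = closure {Ad g N | g. g \<in> G}"
  obtain c where c: "c > 0" "\<And>X. c * norm X ^ 2 \<le> ip h X X"
    using ip_coercive[OF h pos] by blast
  have cont_ip: "continuous_on A (\<lambda>X. ip h X X)" for A
    by (intro bounded_bilinear.continuous_on[OF bounded_bilinear_ip] continuous_intros)
  have N_S: "N \<in> S" unfolding S_def using grpD(2) by (intro subsetD[OF closure_subset]) force
  \<comment> \<open>Only the compact part of \<open>S\<close> where the norm is at most that of \<open>N\<close> matters for the minimum.\<close>
  define B where "B = S \<inter> {X. ip h X X \<le> ip h N N}"
  have "closed {X. ip h X X \<le> ip h N N}"
    by (intro closed_Collect_le cont_ip continuous_on_const)
  moreover have "bounded {X. ip h X X \<le> ip h N N}"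
    unfolding bounded_iff
  proof (intro exI ballI)
    fix X assume "X \<in> {X. ip h X X \<le> ip h N N}"
    then have "c * norm X ^ 2 \<le> ip h N N" using c(2)[of X] by simp
    then have "norm X ^ 2 \<le> ip h N N / c" using c(1) by (simp add: field_simps)
    then show "norm X \<le> sqrt (ip h N N / c)" by (rule real_le_rsqrt)
  qed
  ultimately have B: "compact B"
    unfolding B_def S_def by (intro closed_Int_compact) (auto simp: compact_eq_bounded_closed)
  have "B \<noteq> {}" using N_S by (auto simp: B_def)
  from continuous_attains_inf[OF B this cont_ip]
  obtain Y where "Y \<in> B" "\<And>X. X \<in> B \<Longrightarrow> ip h Y Y \<le> ip h X X"
    by blast
  then have Y: "Y \<in> S" and Ymin: "\<And>X. X \<in> S \<Longrightarrow> ip h Y Y \<le> ip h X X"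
    unfolding B_def by force+
  \<comment> \<open>Properties of \<open>N\<close> that are closed and invariant under conjugation pass to \<open>Y\<close>.\<close>
  have closedD: "Y \<in> T" if "closed T" "\<And>g. g \<in> G \<Longrightarrow> Ad g N \<in> T" for T
  proof -
    have "S \<subseteq> T" unfolding S_def using that by (intro closure_minimal) auto
    with Y show ?thesis by blast
  qed
  have Yder: "Y \<in> lie_derived (lie_alg G)"
    by (rule closedD[OF lie_derived_closed]) (rule Ad_lie_derived[OF grp _ Nder])
  then have Ymem: "Y \<in> lie_alg G" using der_sub by blast
  have "Y \<in> {X. F X = p N}"
  proof (rule closedD)
    show "closed {X. F X = p N}"
      by (intro closed_Collect_eq cpoly_continuous F continuous_on_const)
    show "Ad g N \<in> {X. F X = p N}" if "g \<in> G" for g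
      using F(2)[OF Ad_lie_alg[OF grp that N_mem]] inv[OF that N_mem] by simp
  qed
  then have pY: "p Y = p N" using F(2)[OF Ymem] by simp
  have Ynil: "(bracket Y ^^ k) Z = 0" if Z: "Z \<in> lie_derived (lie_alg G)" for Z
  proof -
    have "Y \<in> {X. (bracket X ^^ k) Z = 0}"
    proof (rule closedD)
      have "continuous_on UNIV (\<lambda>X. (bracket X ^^ k) Z)" for k
        by (induction k) (auto simp: bracket_def intro!: continuous_intros)
      then show "closed {X. (bracket X ^^ k) Z = 0}"
        by (intro closed_Collect_eq continuous_on_const)
      show "Ad g N \<in> {X. (bracket X ^^ k) Z = 0}" if g: "g \<in> G" for g
      proof -
        have "(bracket (Ad g N) ^^ m) (Ad g W) = Ad g ((bracket N ^^ m) W)" for m W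
          by (induction m) (simp_all add: Ad_bracket grpD g)
        from this[of k "Ad (matrix_inv g) Z"] show ?thesis
          using nil[OF Ad_lie_derived[OF grp grpD(4)[OF g] Z]]
          by (simp add: Ad_inv_cancel grpD g linear_0[OF linear_Ad])
      qed
    qed
    then show ?thesis by simp
  qed
  \<comment> \<open>The closure of the orbit is again invariant, so \<open>Y\<close> has least norm in its own orbit.\<close>
  have S_Ad: "Ad g X \<in> S" if g: "g \<in> G" and X: "X \<in> S" for g X
  proof -
    have "Ad g ` S \<subseteq> S"
      unfolding S_def
    proof (rule image_closure_subset)
      show "continuous_on (closure {Ad g N |g. g \<in> G}) (Ad g)"
        using linear_Ad linear_continuous_on linear_conv_bounded_linear by blast
      show "Ad g ` {Ad g N |g. g \<in> G} \<subseteq> closure {Ad g N |g. g \<in> G}"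
        using g by (intro order_trans[OF _ closure_subset]) (auto simp: Ad_Ad grpD intro: grpD)
    qed simp
    with X show ?thesis by blast
  qed
  have critical: "ip h (bracket H Y) Y = 0" if "H \<in> lie_alg G" for H
  proof -
    from that obtain \<gamma> where *: "\<And>t. \<gamma> t \<in> G" "\<gamma> 0 = mat 1" "(\<gamma> has_vector_derivative H) (at 0)"
      by (metis lie_algE)
    have d: "((\<lambda>t. Ad (\<gamma> t) Y) has_vector_derivative bracket H Y) (at 0)"
      using has_vector_derivative_Ad[OF *(3,2)] *(1) grpD(1) by blast
    have "((\<lambda>t. ip h (Ad (\<gamma> t) Y) (Ad (\<gamma> t) Y)) has_real_derivative
        ip h Y (bracket H Y) + ip h (bracket H Y) Y) (at 0)"
      using bounded_bilinear.has_vector_derivative[OF bounded_bilinear_ip d d]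
      by (simp add: has_real_derivative_iff_has_vector_derivative *(2))
    from DERIV_local_min[OF this, of 1] have "ip h Y (bracket H Y) + ip h (bracket H Y) Y = 0"
      using Ymin[OF S_Ad[OF *(1) Y]] by (simp add: *(2))
    then show ?thesis by (simp add: ip_sym[OF h, of Y])
  qed
  have "ip h (bracket (bracket Y (dag h Y)) Y) Y = 0"
    by (intro critical bracket_lie_alg[OF grp] Ymem dag)
  then have normal: "bracket Y (dag h Y) = 0"
    using normal_if_critical[OF h] pos by blast
  have central: "bracket Y B = 0" if "B \<in> lie_alg G" for B
  proof -
    \<comment> \<open>One bracket with \<open>Y\<close> leads from the Lie algebra into its derived algebra.\<close>
    have "(bracket Y ^^ Suc k) B = (bracket Y ^^ k) (bracket Y B)"
      by (simp only: funpow_Suc_right o_apply)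
    also have "\<dots> = 0" by (rule Ynil[OF bracket_lie_derived[OF Ymem that]])
    finally show ?thesis using normal_ad_nilpotent_zero[OF h _ normal] pos by blast
  qed
  have "Y = 0"
    by (rule lie_derived_central_zero[OF h pos Yder central dag])
  with pY show "p N = p 0" by simp
qed

section \<open>Pole orders\<close>

lemma cpoly_holomorphic:
  fixes X :: "complex \<Rightarrow> 'n::finite cmat"
  assumes "cpoly F" "\<And>i j. (\<lambda>y. X y $ i $ j) holomorphic_on S"
  shows "(\<lambda>y. F (X y)) holomorphic_on S"
  using assms(1) by (induction rule: cpoly.induct) (auto intro!: holomorphic_intros assms(2))

lemma cpoly_analytic:
  fixes X :: "complex \<Rightarrow> 'n::finite cmat"
  assumes "cpoly F" "\<And>i j. (\<lambda>y. X y $ i $ j) analytic_on S"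
  shows "(\<lambda>y. F (X y)) analytic_on S"
  using assms(1) by (induction rule: cpoly.induct) (auto intro!: analytic_intros assms(2))

lemma pole_le_cong:
  assumes "pole_le m f a" "\<forall>\<^sub>F y in at a. f y = g y"
  shows "pole_le m g a"
proof -
  from assms(1) obtain h where h: "h analytic_on {a}" "\<forall>\<^sub>F y in at a. (y - a) ^ m * f y = h y"
    by (auto simp: pole_le_def)
  have "\<forall>\<^sub>F y in at a. (y - a) ^ m * g y = h y"
    using h(2) assms(2) by eventually_elim simp
  with h(1) show ?thesis by (auto simp: pole_le_def)
qed

lemma pole_le_mono:
  assumes "pole_le m f a" "m \<le> n"
  shows "pole_le n f a"
proof -
  from assms(1) obtain h where h: "h analytic_on {a}" "\<forall>\<^sub>F y in at a. (y - a) ^ m * f y = h y"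
    by (auto simp: pole_le_def)
  have "(\<lambda>y. (y - a) ^ (n - m) * h y) analytic_on {a}"
    by (intro analytic_intros h)
  moreover have "\<forall>\<^sub>F y in at a. (y - a) ^ n * f y = (y - a) ^ (n - m) * h y"
    using h(2)
  proof eventually_elim
    case (elim y)
    have "(y - a) ^ n = (y - a) ^ (n - m) * (y - a) ^ m"
      using assms(2) by (simp add: power_add[symmetric])
    with elim show ?case by simp
  qed
  ultimately show ?thesis by (auto simp: pole_le_def)
qed

lemma residue_simple_pole_le:
  assumes h: "h analytic_on {a}" and ev: "\<forall>\<^sub>F y in at a. (y - a) ^ 1 * f y = h y"
  shows "residue f a = h a"
proof -
  from h obtain s where s: "open s" "a \<in> s" "h holomorphic_on s" by (auto simp: analytic_at)
  have "\<forall>\<^sub>F y in at a. f y = h y / (y - a)"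
    using ev eventually_neq_at_within[of a a UNIV] by eventually_elim (simp add: field_simps)
  then have "residue f a = residue (\<lambda>y. h y / (y - a)) a"
    by (rule residue_cong) simp
  with residue_simple[OF s] show ?thesis by simp
qed

lemma analytic_zero_factor:
  assumes f: "f analytic_on {a}" and zero: "f a = 0"
  obtains k where "k analytic_on {a}" "\<And>y. y \<noteq> a \<Longrightarrow> f y = (y - a) * k y"
proof -
  from f obtain s where s: "open s" "a \<in> s" "f holomorphic_on s" by (auto simp: analytic_at)
  define k where "k y = (if y = a then deriv f a else (f y - f a) / (y - a))" for y
  have "k holomorphic_on s"
    using pole_lemma_open[OF s(3,1), of a] unfolding k_def .
  with s show thesis
    by (intro that[of k]) (auto simp: analytic_at k_def zero)
qed

text \<open>If \<open>X\<close> has at most a simple pole at \<open>a\<close> with residue \<open>R\<close>, then \<open>(y - a) X\<close> extends analytically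
  with value \<open>R\<close> at \<open>a\<close>, and so does \<open>(y - a)\<^sup>d F(X) = F((y - a) X)\<close> with value \<open>F(R)\<close>.\<close>

lemma pole_le_homogeneous:
  fixes X :: "complex \<Rightarrow> 'n::finite cmat"
  assumes F: "cpoly F" and hom: "\<And>c Y. Y \<in> V \<Longrightarrow> F (cscale c Y) = c ^ d * F Y"
    and V: "\<forall>\<^sub>F y in at a. X y \<in> V" and pole: "\<And>i j. pole_le 1 (\<lambda>y. X y $ i $ j) a"
  shows "pole_le d (\<lambda>y. F (X y)) a"
    and "F (\<chi> i j. residue (\<lambda>y. X y $ i $ j) a) = 0 \<Longrightarrow> d > 0 \<Longrightarrow>
      pole_le (d - 1) (\<lambda>y. F (X y)) a"
proof -
  from pole have "\<forall>i j. \<exists>h. h analytic_on {a} \<and> (\<forall>\<^sub>F y in at a. (y - a) ^ 1 * X y $ i $ j = h y)"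
    by (simp add: pole_le_def)
  then obtain h where *: "\<forall>i j. h i j analytic_on {a} \<and> (\<forall>\<^sub>F y in at a. (y - a) ^ 1 * X y $ i $ j = h i j y)"
    unfolding choice_iff by (rule exE)
  have h: "h i j analytic_on {a}" "\<forall>\<^sub>F y in at a. (y - a) ^ 1 * X y $ i $ j = h i j y" for i j
    using * by simp_all
  define H where "H y = (\<chi> i j. h i j y)" for y
  have FH: "(\<lambda>y. F (H y)) analytic_on {a}"
    by (rule cpoly_analytic[OF F]) (simp add: H_def h)
  have "\<forall>\<^sub>F y in at a. \<forall>i j. (y - a) ^ 1 * X y $ i $ j = h i j y"
    by (simp only: eventually_all_finite h(2))
  then have ev: "\<forall>\<^sub>F y in at a. (y - a) ^ d * F (X y) = F (H y)"
    using V
  proof eventually_elim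
    case (elim y)
    then have "H y = cscale (y - a) (X y)" by (simp add: H_def cscale_def vec_eq_iff)
    with hom[OF elim(2)] show ?case by simp
  qed
  with FH show "pole_le d (\<lambda>y. F (X y)) a" by (auto simp: pole_le_def)
  assume R: "F (\<chi> i j. residue (\<lambda>y. X y $ i $ j) a) = 0" and d: "d > 0"
  have "residue (\<lambda>y. X y $ i $ j) a = h i j a" for i j
    by (rule residue_simple_pole_le[OF h])
  with R have "F (H a) = 0" by (simp add: H_def)
  with FH obtain k where k: "k analytic_on {a}" "\<And>y. y \<noteq> a \<Longrightarrow> F (H y) = (y - a) * k y"
    by (rule analytic_zero_factor) auto
  have "\<forall>\<^sub>F y in at a. (y - a) ^ (d - 1) * F (X y) = k y"
    using ev eventually_neq_at_within[of a a UNIV]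
  proof eventually_elim
    case (elim y)
    have "(y - a) * ((y - a) ^ (d - 1) * F (X y)) = (y - a) ^ d * F (X y)"
      using d by (simp add: power_eq_if)
    with elim k(2)[of y] have "(y - a) * ((y - a) ^ (d - 1) * F (X y)) = (y - a) * k y" by simp
    then show ?case using elim(2) by simp
  qed
  with k(1) show "pole_le (d - 1) (\<lambda>y. F (X y)) a" by (auto simp: pole_le_def)
qed

section \<open>Higgs fields in charts and local trivializations\<close>

lemma chart_pt_inverse:
  assumes "is_chart c" "x \<in> fst c"
  shows "chart_pt c (snd c x) = x"
  using assms by (auto simp: is_chart_def homeomorphism_def)

lemma open_chart_image:
  assumes c: "is_chart c" and V: "open V"
  shows "open (snd c ` (fst c \<inter> V))"
proof -
  have "openin (top_of_set (snd c ` fst c)) (snd c ` (fst c \<inter> V))"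
    using c V by (intro homeomorphism_imp_open_map[of "fst c" _ _ "chart_pt c"])
      (auto simp: is_chart_def openin_open)
  moreover have "open (snd c ` fst c)" using c by (simp only: is_chart_def)
  ultimately show ?thesis by (rule openin_open_trans)
qed

lemma torsor_bundleD:
  assumes "torsor_bundle G P"
  shows "\<And>a g. a \<in> total P \<Longrightarrow> g \<in> G \<Longrightarrow> act P a g \<in> total P"
    "\<And>a g. a \<in> total P \<Longrightarrow> g \<in> G \<Longrightarrow> proj P (act P a g) = proj P a"
    "\<And>a. a \<in> total P \<Longrightarrow> act P a (mat 1) = a"
    "\<And>a b. a \<in> total P \<Longrightarrow> b \<in> total P \<Longrightarrow> proj P a = proj P b \<Longrightarrow> \<exists>!g. g \<in> G \<and> act P a g = b"
    "\<And>s. s \<in> triv P \<Longrightarrow> local_section P s" "(\<Union>s\<in>triv P. fst s) = UNIV"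
  using assms unfolding torsor_bundle_def by blast+

text \<open>Each element of the fibre of the adjoint bundle has exactly one coordinate at each point of
  the principal fibre.\<close>

lemma ad_fibre_coord:
  assumes P: "torsor_bundle G P" and G: "matrix_subgroup G" and e: "e \<in> ad_fibre G P x"
    and b: "b \<in> total P" "proj P b = x"
  shows "(b, ad_coord e b) \<in> e" "ad_coord e b \<in> lie_alg G"
proof -
  from e obtain a X where a: "a \<in> total P" "proj P a = x" "X \<in> lie_alg G"
    and e_eq: "e = ad_class G P a X"
    unfolding ad_fibre_def by blast
  have uniq: "\<exists>!g. g \<in> G \<and> act P a g = b"
    by (rule torsor_bundleD(4)[OF P]) (use a b in auto)
  then obtain g where g: "g \<in> G" "act P a g = b" by blast
  have "(b, Y) \<in> e \<longleftrightarrow> Y = Ad (matrix_inv g) X" for Y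
  proof
    assume "(b, Y) \<in> e"
    then obtain g' where g': "g' \<in> G" "act P a g' = b" "Y = Ad (matrix_inv g') X"
      unfolding e_eq ad_class_def by auto
    then have "g' = g" using g uniq by (metis (no_types))
    then show "Y = Ad (matrix_inv g) X" using g' by simp
  next
    assume "Y = Ad (matrix_inv g) X"
    then have "(b, Y) = (act P a g, Ad (matrix_inv g) X)" using g(2) by simp
    with g(1) show "(b, Y) \<in> e" unfolding e_eq ad_class_def by blast
  qed
  then have *: "ad_coord e b = Ad (matrix_inv g) X" "(b, Ad (matrix_inv g) X) \<in> e"
    by (auto simp: ad_coord_def)
  then show "(b, ad_coord e b) \<in> e" by simp
  show "ad_coord e b \<in> lie_alg G"
    using * Ad_lie_alg[OF G matrix_subgroupD(4)[OF G g(1)] a(3)] by simp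
qed

text \<open>An invariant polynomial has the same value on all representatives of an element of the fibre
  of the adjoint bundle.\<close>

lemma ad_fibre_invariant:
  assumes G: "matrix_subgroup G" and e: "e \<in> ad_fibre G P x"
    and p: "invariant_poly G p" and X: "(a, X) \<in> e"
  shows "the_elem ((\<lambda>(a, X). p X) ` e) = p X" "X \<in> lie_alg G"
proof -
  from e obtain a0 X0 where X0: "X0 \<in> lie_alg G" and e_eq: "e = ad_class G P a0 X0"
    unfolding ad_fibre_def by blast
  have inv: "p (Ad g X0) = p X0" if "g \<in> G" for g
  proof -
    have "\<forall>g\<in>G. \<forall>X\<in>lie_alg G. p (Ad g X) = p X"
      using p unfolding invariant_poly_def by (rule conjunct2)
    from bspec[OF bspec[OF this that] X0] show ?thesis .
  qed
  have *: "Y \<in> lie_alg G \<and> p Y = p X0" if "(b, Y) \<in> e" for b Y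
  proof -
    from that obtain g where g: "g \<in> G" "Y = Ad (matrix_inv g) X0"
      unfolding e_eq ad_class_def by blast
    have g': "matrix_inv g \<in> G" by (rule matrix_subgroupD(4)[OF G g(1)])
    show ?thesis unfolding g(2) using Ad_lie_alg[OF G g' X0] inv[OF g'] by (rule conjI)
  qed
  have "(\<lambda>(a, X). p X) ` e = (\<lambda>_. p X0) ` e"
  proof (rule image_cong[OF refl])
    fix z assume "z \<in> e"
    then have "p (snd z) = p X0" using *[of "fst z" "snd z"] by simp
    then show "(case z of (a, X) \<Rightarrow> p X) = p X0" by (simp only: case_prod_beta)
  qed
  also have "\<dots> = {p X0}" using X by blast
  finally show "the_elem ((\<lambda>(a, X). p X) ` e) = p X" using *[OF X] by simp
  show "X \<in> lie_alg G" using *[OF X] by simp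
qed

lemma complex_structureD:
  assumes "complex_structure A"
  shows "\<And>c. c \<in> A \<Longrightarrow> is_chart c"
  using assms by (auto simp: complex_structure_def)

context
  fixes A :: "'c::t2_space chart set" and D :: "'c set" and G :: "'n::finite cmat set"
    and P :: "('p, 'c, 'n) pbundle" and \<Phi> :: "('p, 'c, 'n) higgs_field"
    and p :: "'n cmat \<Rightarrow> complex" and d :: nat
  assumes A: "complex_structure A" and D: "finite D" and red: "connected_complex_reductive G"
    and higgs: "(P, \<Phi>) \<in> log_higgs_bundles A D G"
    and p: "invariant_poly G p" and hom: "homogeneous G d p"
begin

lemma grp: "matrix_subgroup G"
  using red by (simp add: connected_complex_reductive_def)

lemma torsor: "torsor_bundle G P"
  using higgs by (auto simp: log_higgs_bundles_def holomorphic_principal_bundle_def)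

lemma log_higgs_fieldD:
  "\<And>c x. c \<in> A \<Longrightarrow> x \<in> fst c - D \<Longrightarrow> \<Phi> c x \<in> ad_fibre G P x"
  "\<And>b c x. b \<in> A \<Longrightarrow> c \<in> A \<Longrightarrow> x \<in> fst b \<inter> fst c - D \<Longrightarrow> \<Phi> c x = ad_scale (jac b c x) (\<Phi> b x)"
  "\<And>c s i j. c \<in> A \<Longrightarrow> s \<in> triv P \<Longrightarrow>
      (\<lambda>y. higgs_coeff \<Phi> c s y $ i $ j) holomorphic_on (snd c ` (fst c \<inter> fst s - D))"
  "\<And>c s i j x. c \<in> A \<Longrightarrow> s \<in> triv P \<Longrightarrow> x \<in> fst c \<inter> fst s \<inter> D \<Longrightarrow>
      pole_le 1 (\<lambda>y. higgs_coeff \<Phi> c s y $ i $ j) (snd c x)"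
proof -
  have "log_higgs_field A D G P \<Phi>" using higgs by (simp add: log_higgs_bundles_def)
  note * = this[unfolded log_higgs_field_def]
  show "\<And>c x. c \<in> A \<Longrightarrow> x \<in> fst c - D \<Longrightarrow> \<Phi> c x \<in> ad_fibre G P x"
    using * by blast
  show "\<And>b c x. b \<in> A \<Longrightarrow> c \<in> A \<Longrightarrow> x \<in> fst b \<inter> fst c - D \<Longrightarrow> \<Phi> c x = ad_scale (jac b c x) (\<Phi> b x)"
    using * by blast
  show "\<And>c s i j. c \<in> A \<Longrightarrow> s \<in> triv P \<Longrightarrow>
      (\<lambda>y. higgs_coeff \<Phi> c s y $ i $ j) holomorphic_on (snd c ` (fst c \<inter> fst s - D))"
    using * by blast
  show "\<And>c s i j x. c \<in> A \<Longrightarrow> s \<in> triv P \<Longrightarrow> x \<in> fst c \<inter> fst s \<inter> D \<Longrightarrow>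
      pole_le 1 (\<lambda>y. higgs_coeff \<Phi> c s y $ i $ j) (snd c x)"
    using * by blast
qed

lemma eval_inv_local:
  assumes c: "c \<in> A" and s: "s \<in> triv P" and x: "x \<in> fst c \<inter> fst s - D"
  shows "eval_inv A D p \<Phi> c x = p (higgs_coeff \<Phi> c s (snd c x))"
    and "higgs_coeff \<Phi> c s (snd c x) \<in> lie_alg G"
proof -
  have pt: "chart_pt c (snd c x) = x"
    using chart_pt_inverse complex_structureD[OF A c] x by blast
  have e: "\<Phi> c x \<in> ad_fibre G P x" using log_higgs_fieldD(1)[OF c] x by blast
  have sx: "snd s x \<in> total P" "proj P (snd s x) = x"
    using torsor_bundleD(5)[OF torsor s] x by (auto simp: local_section_def)
  note * = ad_fibre_coord[OF torsor grp e sx]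
  show "higgs_coeff \<Phi> c s (snd c x) \<in> lie_alg G" using *(2) by (simp add: higgs_coeff_def pt)
  show "eval_inv A D p \<Phi> c x = p (higgs_coeff \<Phi> c s (snd c x))"
    using ad_fibre_invariant(1)[OF grp e p *(1)] c x by (simp add: eval_inv_def higgs_coeff_def pt)
qed

lemma eval_inv_transform:
  assumes b: "b \<in> A" and c: "c \<in> A" and x: "x \<in> fst b \<inter> fst c - D"
  shows "eval_inv A D p \<Phi> c x = eval_inv A D p \<Phi> b x * jac b c x ^ d"
proof -
  have eb: "\<Phi> b x \<in> ad_fibre G P x" using log_higgs_fieldD(1)[OF b] x by blast
  have ec: "\<Phi> c x \<in> ad_fibre G P x" using log_higgs_fieldD(1)[OF c] x by blast
  obtain s where s: "s \<in> triv P" "x \<in> fst s" using torsor_bundleD(6)[OF torsor] by blast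
  have sx: "snd s x \<in> total P" "proj P (snd s x) = x"
    using torsor_bundleD(5)[OF torsor s(1)] s(2) by (auto simp: local_section_def)
  define X where "X = ad_coord (\<Phi> b x) (snd s x)"
  have X: "(snd s x, X) \<in> \<Phi> b x" "X \<in> lie_alg G"
    unfolding X_def by (rule ad_fibre_coord[OF torsor grp eb sx])+
  have "(snd s x, cscale (jac b c x) X) \<in> \<Phi> c x"
    using log_higgs_fieldD(2)[OF b c x] X(1) by (auto simp: ad_scale_def)
  from ad_fibre_invariant(1)[OF grp ec p this]
  have "eval_inv A D p \<Phi> c x = p (cscale (jac b c x) X)" using c x by (simp add: eval_inv_def)
  also have "\<dots> = jac b c x ^ d * p X" using hom X(2) by (simp add: homogeneous_def)
  also have "p X = eval_inv A D p \<Phi> b x"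
    using ad_fibre_invariant(1)[OF grp eb p X(1)] b x by (simp add: eval_inv_def)
  finally show ?thesis by (simp add: mult.commute)
qed

text \<open>The local expressions below use a polynomial \<open>F\<close> in the matrix entries that agrees with \<open>p\<close> on the
  Lie algebra; \<open>p\<close> itself is arbitrary elsewhere.\<close>

lemma eval_inv_holomorphic:
  assumes c: "c \<in> A"
  shows "(\<lambda>y. eval_inv A D p \<Phi> c (chart_pt c y)) holomorphic_on (snd c ` (fst c - D))"
proof -
  note ch = complex_structureD[OF A c]
  obtain F where F: "cpoly F" "\<And>X. X \<in> lie_alg G \<Longrightarrow> p X = F X"
    using p unfolding invariant_poly_def by blast
  have "(\<lambda>y. eval_inv A D p \<Phi> c (chart_pt c y)) holomorphic_on
      (\<Union>s\<in>triv P. snd c ` (fst c \<inter> fst s - D))"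
  proof (rule holomorphic_on_UN_open)
    fix s assume s: "s \<in> triv P"
    have "open (fst s)" using torsor_bundleD(5)[OF torsor s] by (simp add: local_section_def)
    then have "open (fst s - D)" using D by (intro open_Diff finite_imp_closed)
    from open_chart_image[OF ch this]
    show "open (snd c ` (fst c \<inter> fst s - D))" by (simp add: Int_Diff)
    have "(\<lambda>y. F (higgs_coeff \<Phi> c s y)) holomorphic_on (snd c ` (fst c \<inter> fst s - D))"
      by (rule cpoly_holomorphic[OF F(1) log_higgs_fieldD(3)[OF c s]])
    moreover have "F (higgs_coeff \<Phi> c s y) = eval_inv A D p \<Phi> c (chart_pt c y)"
      if "y \<in> snd c ` (fst c \<inter> fst s - D)" for y
    proof -
      from that obtain z where z: "z \<in> fst c \<inter> fst s - D" "y = snd c z" by blast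
      then have "chart_pt c y = z" by (simp add: chart_pt_inverse[OF ch])
      with eval_inv_local[OF c s z(1)] F(2) show ?thesis by (simp add: z(2))
    qed
    ultimately show "(\<lambda>y. eval_inv A D p \<Phi> c (chart_pt c y)) holomorphic_on
        (snd c ` (fst c \<inter> fst s - D))"
      by (simp cong: holomorphic_cong)
  qed
  also have "(\<Union>s\<in>triv P. snd c ` (fst c \<inter> fst s - D)) = snd c ` (fst c \<inter> (\<Union>s\<in>triv P. fst s) - D)"
    by blast
  finally show ?thesis by (simp add: torsor_bundleD(6)[OF torsor])
qed

lemma eval_inv_pole:
  assumes c: "c \<in> A" and x: "x \<in> fst c \<inter> D"
  shows "pole_le d (\<lambda>y. eval_inv A D p \<Phi> c (chart_pt c y)) (snd c x)"
    and "nilpotent_residues A D G P \<Phi> \<Longrightarrow> d > 0 \<Longrightarrow>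
      pole_le (d - 1) (\<lambda>y. eval_inv A D p \<Phi> c (chart_pt c y)) (snd c x)"
proof -
  note ch = complex_structureD[OF A c]
  obtain F where F: "cpoly F" "\<And>X. X \<in> lie_alg G \<Longrightarrow> p X = F X"
    using p unfolding invariant_poly_def by blast
  obtain s where s: "s \<in> triv P" "x \<in> fst s" using torsor_bundleD(6)[OF torsor] by blast
  \<comment> \<open>A neighbourhood of \<open>x\<close> in which \<open>x\<close> is the only marked point.\<close>
  define U where "U = snd c ` (fst c \<inter> (fst s - (D - {x})))"
  have "open (fst s)" using torsor_bundleD(5)[OF torsor s(1)] by (simp add: local_section_def)
  then have "open (fst s - (D - {x}))" using D by (intro open_Diff finite_imp_closed) auto
  then have "open U" unfolding U_def by (rule open_chart_image[OF ch])
  moreover have "snd c x \<in> U" using x s unfolding U_def by (intro imageI) blast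
  ultimately have "\<forall>\<^sub>F y in at (snd c x). y \<in> U"
    by (rule eventually_at_in_open')
  then have ev: "\<forall>\<^sub>F y in at (snd c x). y \<in> snd c ` (fst c \<inter> fst s - D)"
    using eventually_neq_at_within[of "snd c x" "snd c x" UNIV]
  proof eventually_elim
    case (elim y)
    then obtain z where z: "z \<in> fst c \<inter> (fst s - (D - {x}))" "y = snd c z" by (auto simp: U_def)
    with elim(2) have "z \<noteq> x" by blast
    with z have "z \<in> fst c \<inter> fst s - D" by blast
    with z(2) show ?case by blast
  qed
  have mem: "\<forall>\<^sub>F y in at (snd c x). higgs_coeff \<Phi> c s y \<in> lie_alg G"
    using ev
  proof eventually_elim
    case (elim y)
    then obtain z where z: "z \<in> fst c \<inter> fst s - D" "y = snd c z" by blast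
    show ?case unfolding z(2) by (rule eval_inv_local(2)[OF c s(1) z(1)])
  qed
  have eq: "\<forall>\<^sub>F y in at (snd c x). F (higgs_coeff \<Phi> c s y) = eval_inv A D p \<Phi> c (chart_pt c y)"
    using ev mem
  proof eventually_elim
    case (elim y)
    then obtain z where z: "z \<in> fst c \<inter> fst s - D" "y = snd c z" by blast
    then have "chart_pt c y = z" by (simp add: chart_pt_inverse[OF ch])
    with F(2)[OF elim(2)] eval_inv_local(1)[OF c s(1) z(1)] show ?case by (simp add: z(2))
  qed
  have poles: "pole_le 1 (\<lambda>y. higgs_coeff \<Phi> c s y $ i $ j) (snd c x)" for i j
    using log_higgs_fieldD(4)[OF c s(1)] x s(2) by blast
  have sub: "cmat.subspace (lie_alg G)" using reductive_metric[OF red] by blast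
  have F_hom: "F (cscale z Y) = z ^ d * F Y" if "Y \<in> lie_alg G" for z Y
    using hom that F(2)[OF that] F(2)[OF cmat.subspace_scale[OF sub that]]
    by (simp add: homogeneous_def)
  show "pole_le d (\<lambda>y. eval_inv A D p \<Phi> c (chart_pt c y)) (snd c x)"
    by (rule pole_le_cong[OF pole_le_homogeneous(1)[OF F(1) _ mem poles] eq]) (rule F_hom)
  assume nil: "nilpotent_residues A D G P \<Phi>" and d: "d > 0"
  have res: "lie_nilpotent (lie_alg G) (higgs_residue \<Phi> c s x)"
    using nil c s x unfolding nilpotent_residues_def by blast
  have "F (higgs_residue \<Phi> c s x) = p 0"
    using invariant_poly_nilpotent[OF red p res] F(2) by simp
  \<comment> \<open>Homogeneity of positive degree at the scalar \<open>0\<close>.\<close>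
  also have "p 0 = F (cscale 0 0)"
    using F(2)[OF cmat.subspace_0[OF sub]] by simp
  also have "\<dots> = 0"
    using F_hom[OF cmat.subspace_0[OF sub], of 0] d by (simp add: zero_power)
  finally have "F (\<chi> i j. residue (\<lambda>y. higgs_coeff \<Phi> c s y $ i $ j) (snd c x)) = 0"
    by (simp add: higgs_residue_def)
  with d have "pole_le (d - 1) (\<lambda>y. F (higgs_coeff \<Phi> c s y)) (snd c x)"
    using pole_le_homogeneous(2)[OF F(1) _ mem poles] F_hom by blast
  then show "pole_le (d - 1) (\<lambda>y. eval_inv A D p \<Phi> c (chart_pt c y)) (snd c x)"
    by (rule pole_le_cong[OF _ eq])
qed

lemma eval_inv_log_differentials:
  shows "eval_inv A D p \<Phi> \<in> log_differentials A D d d"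
    and "nilpotent_residues A D G P \<Phi> \<Longrightarrow> d > 0 \<Longrightarrow>
      eval_inv A D p \<Phi> \<in> log_differentials A D d (d - 1)"
proof -
  have outside: "\<forall>c x. c \<notin> A \<or> x \<notin> fst c - D \<longrightarrow> eval_inv A D p \<Phi> c x = 0"
    by (intro allI impI, unfold eval_inv_def, rule if_not_P) blast
  show "eval_inv A D p \<Phi> \<in> log_differentials A D d d"
    unfolding log_differentials_def mem_Collect_eq
    by (intro conjI ballI outside eval_inv_transform eval_inv_holomorphic eval_inv_pole(1))
  show "eval_inv A D p \<Phi> \<in> log_differentials A D d (d - 1)"
    if "nilpotent_residues A D G P \<Phi>" "d > 0"
    unfolding log_differentials_def mem_Collect_eq
    by (intro conjI ballI outside eval_inv_transform eval_inv_holomorphic eval_inv_pole(2) that)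
qed

end

section \<open>The Hitchin map on moduli\<close>

lemma log_differentials_mono:
  assumes "m \<le> n"
  shows "log_differentials A D d m \<subseteq> log_differentials A D d n"
proof
  fix q assume "q \<in> log_differentials A D d m"
  note q = this[unfolded log_differentials_def mem_Collect_eq]
  have "\<forall>c\<in>A. \<forall>x\<in>fst c \<inter> D. pole_le n (\<lambda>y. q c (chart_pt c y)) (snd c x)"
  proof (intro ballI)
    fix c x assume "c \<in> A" "x \<in> fst c \<inter> D"
    with q have "pole_le m (\<lambda>y. q c (chart_pt c y)) (snd c x)" by blast
    then show "pole_le n (\<lambda>y. q c (chart_pt c y)) (snd c x)" by (rule pole_le_mono[OF _ assms])
  qed
  with q show "q \<in> log_differentials A D d n"
    unfolding log_differentials_def mem_Collect_eq by (elim conjE) (intro conjI)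
qed

lemma hitchin_base_mono:
  "(\<And>j. j < l \<Longrightarrow> m j \<le> n j) \<Longrightarrow> hitchin_base A D l d m \<subseteq> hitchin_base A D l d n"
  unfolding hitchin_base_def by (intro PiE_mono log_differentials_mono) simp

lemma hitchin_in_base:
  fixes A :: "'c::t2_space chart set"
  assumes A: "complex_structure A" and D: "finite D" and G: "connected_complex_reductive G"
    and gen: "homogeneous_generators G l p d" and higgs: "(P, \<Phi>) \<in> log_higgs_bundles A D G"
  shows "hitchin A D l p (P, \<Phi>) \<in> hitchin_base A D l d d"
    and "nilpotent_residues A D G P \<Phi> \<Longrightarrow>
      hitchin A D l p (P, \<Phi>) \<in> hitchin_base A D l d (\<lambda>j. d j - 1)"
proof -
  have *: "invariant_poly G (p j)" "homogeneous G (d j) (p j)" "d j > 0" if "j \<in> {..<l}" for j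
    using gen that by (simp_all add: homogeneous_generators_def)
  show "hitchin A D l p (P, \<Phi>) \<in> hitchin_base A D l d d"
    unfolding hitchin_def hitchin_base_def case_prod_conv restrict_PiE_iff
    by (intro ballI eval_inv_log_differentials(1)[OF A D G higgs] *)
  show "hitchin A D l p (P, \<Phi>) \<in> hitchin_base A D l d (\<lambda>j. d j - 1)"
    if "nilpotent_residues A D G P \<Phi>"
    unfolding hitchin_def hitchin_base_def case_prod_conv restrict_PiE_iff
    by (intro ballI eval_inv_log_differentials(2)[OF A D G higgs] * that)
qed

lemma higgs_iso_refl:
  assumes H: "(P, \<Phi>) \<in> log_higgs_bundles A D G"
  shows "((P, \<Phi>), (P, \<Phi>)) \<in> higgs_iso A D G"
proof -
  have hol: "holo_matrix A (fst s \<inter> fst t) (\<lambda>x. quot G P (snd t x) (snd s x))"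
    if "s \<in> triv P" "t \<in> triv P" for s t
  proof -
    have "\<forall>s\<in>triv P. \<forall>t\<in>triv P. holo_matrix A (fst s \<inter> fst t) (\<lambda>x. quot G P (snd s x) (snd t x))"
      using H by (simp add: log_higgs_bundles_def holomorphic_principal_bundle_def)
    then show ?thesis using that by (subst Int_commute) blast
  qed
  have "\<exists>f. bundle_map G P P f \<and>
     (\<forall>s\<in>triv P. \<forall>t\<in>triv P.
        holo_matrix A (fst s \<inter> fst t) (\<lambda>x. quot G P (snd t x) (f (snd s x)))) \<and>
     (\<forall>c\<in>A. \<forall>x\<in>fst c - D. \<Phi> c x = {(f a, X) | a X. (a, X) \<in> \<Phi> c x})"
    by (rule exI[of _ "\<lambda>a. a"]) (simp add: bundle_map_def hol)
  with H show ?thesis by (simp add: higgs_iso_def)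
qed

text \<open>An isomorphism moves the points of the principal bundle and keeps the matrices that occur as
  coordinates of the Higgs field, so the sets of values of \<open>p j\<close> do not change.\<close>

lemma hitchin_higgs_iso:
  assumes "(H, H') \<in> higgs_iso A D G"
  shows "hitchin A D l p H = hitchin A D l p H'"
proof -
  obtain P \<Phi> P' \<Phi>' where HH: "H = (P, \<Phi>)" "H' = (P', \<Phi>')" by (cases H, cases H')
  have "\<exists>f. \<forall>c\<in>A. \<forall>x\<in>fst c - D. \<Phi>' c x = {(f a, X) | a X. (a, X) \<in> \<Phi> c x}"
    using assms unfolding HH higgs_iso_def mem_Collect_eq case_prod_conv
    by (elim conjE exE) (rule exI)
  then obtain f where "\<forall>c\<in>A. \<forall>x\<in>fst c - D. \<Phi>' c x = {(f a, X) | a X. (a, X) \<in> \<Phi> c x}"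
    by (rule exE)
  note f = this[rule_format]
  have "(\<lambda>(a, X). p j X) ` \<Phi> c x = (\<lambda>(a, X). p j X) ` \<Phi>' c x"
    if "c \<in> A" "x \<in> fst c - D" for c x j
    unfolding f[OF that] by (force simp: image_iff)
  then have "eval_inv A D (p j) \<Phi> = eval_inv A D (p j) \<Phi>'" for j
    by (intro ext) (simp add: eval_inv_def)
  then show ?thesis by (simp add: HH hitchin_def)
qed

lemma higgs_moduli_class:
  assumes "E \<in> higgs_moduli A D G"
  shows "E \<noteq> {}" "\<And>H. H \<in> E \<Longrightarrow> H \<in> log_higgs_bundles A D G"
    "\<And>H. H \<in> E \<Longrightarrow> hitchin_map A D l p E = hitchin A D l p H"
proof -
  from assms obtain H0 where H0: "H0 \<in> log_higgs_bundles A D G" "E = higgs_iso A D G `` {H0}"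
    unfolding higgs_moduli_def by (rule quotientE)
  have "H0 \<in> E" using H0 higgs_iso_refl by (cases H0) auto
  then show "E \<noteq> {}" by blast
  show "H \<in> log_higgs_bundles A D G" if "H \<in> E" for H
    using that H0(2) by (auto simp: higgs_iso_def)
  have const: "hitchin A D l p H = hitchin A D l p H0" if "H \<in> E" for H
    using hitchin_higgs_iso[of H0 H] that H0(2) by auto
  then have "hitchin A D l p ` E = {hitchin A D l p H0}"
    using \<open>H0 \<in> E\<close> by blast
  then show "hitchin_map A D l p E = hitchin A D l p H" if "H \<in> E" for H
    using const[OF that] by (simp add: hitchin_map_def)
qed

lemma teichmueller_complex_structure:
  assumes "t \<in> teichmueller A D" "B \<in> t"
  shows "complex_structure B"
  using assms unfolding teichmueller_def quotient_def by auto

theorem corollary5p4: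
  fixes A :: "'c::t2_space chart set" and D :: "'c set"
    and G :: "'n::finite cmat set"
    and p :: "nat \<Rightarrow> 'n cmat \<Rightarrow> complex" and d :: "nat \<Rightarrow> nat" and l g :: nat
    and P\<^sub>0 :: "('p, 'c, 'n) pbundle"
    and C :: "'c chart set set \<Rightarrow> 'c chart set"
    and M :: "('c chart set set \<times> (('p, 'c, 'n) pbundle \<times> ('p, 'c, 'n) higgs_field) set) set"
  assumes curve: "compact_riemann_surface g A" "g \<ge> 2" "finite D"
    and group: "connected_complex_reductive G"
    and generators: "homogeneous_generators G l p d"
    and top_type: "topological_principal_bundle G P\<^sub>0"
    and universal_curve: "\<And>t. t \<in> teichmueller A D \<Longrightarrow> C t \<in> t"
    and family: "M \<subseteq> (SIGMA t:teichmueller A D. stable_nil_moduli (C t) D G P\<^sub>0)"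
  shows
    "(\<forall>(P, \<Phi>)\<in>(log_higgs_bundles A D G :: (('p, 'c, 'n) pbundle \<times> ('p, 'c, 'n) higgs_field) set).
        nilpotent_residues A D G P \<Phi> \<longrightarrow>
          hitchin A D l p (P, \<Phi>) \<in> hitchin_base A D l d (\<lambda>j. d j - 1)) \<and>
     (\<forall>t\<in>teichmueller A D.
        (\<forall>E\<in>(higgs_moduli (C t) D G :: (('p, 'c, 'n) pbundle \<times> ('p, 'c, 'n) higgs_field) set set).
           (\<forall>H\<in>E. hitchin_map (C t) D l p E = hitchin (C t) D l p H) \<and>
           hitchin_map (C t) D l p E \<in> hitchin_base (C t) D l d d) \<and>
        hitchin_base (C t) D l d (\<lambda>j. d j - 1) \<subseteq> hitchin_base (C t) D l d d) \<and>
     (\<exists>h. \<forall>(t, E)\<in>M.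
        h (t, E) \<in> hitchin_base (C t) D l d (\<lambda>j. d j - 1) \<and>
        hitchin_map (C t) D l p E = h (t, E))"
proof -
  have A: "complex_structure A" using curve(1) by (simp add: compact_riemann_surface_def)
  have C: "complex_structure (C t)" if "t \<in> teichmueller A D" for t
    using teichmueller_complex_structure[OF that universal_curve[OF that]] .
  have base: "hitchin A D l p (P, \<Phi>) \<in> hitchin_base A D l d (\<lambda>j. d j - 1)"
    if "(P, \<Phi>) \<in> log_higgs_bundles A D G" "nilpotent_residues A D G P \<Phi>"
    for P :: "('p, 'c, 'n) pbundle" and \<Phi>
    by (rule hitchin_in_base(2)[OF A curve(3) group generators that])
  have moduli: "(\<forall>H\<in>E. hitchin_map (C t) D l p E = hitchin (C t) D l p H) \<and>
      hitchin_map (C t) D l p E \<in> hitchin_base (C t) D l d d"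
    if t: "t \<in> teichmueller A D" and E: "E \<in> higgs_moduli (C t) D G"
    for t and E :: "(('p, 'c, 'n) pbundle \<times> ('p, 'c, 'n) higgs_field) set"
  proof -
    obtain P \<Phi> where H: "(P, \<Phi>) \<in> E" using higgs_moduli_class(1)[OF E] by fastforce
    show ?thesis
      using hitchin_in_base(1)[OF C[OF t] curve(3) group generators higgs_moduli_class(2)[OF E H]]
        higgs_moduli_class(3)[OF E] H by auto
  qed
  have sub: "hitchin_base (C t) D l d (\<lambda>j. d j - 1) \<subseteq> hitchin_base (C t) D l d d" for t
    by (rule hitchin_base_mono) simp
  have factor: "hitchin_map (C t) D l p E \<in> hitchin_base (C t) D l d (\<lambda>j. d j - 1)"
    if "(t, E) \<in> M" for t E
  proof -
    from that family have t: "t \<in> teichmueller A D" and "E \<in> stable_nil_moduli (C t) D G P\<^sub>0"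
      by auto
    then have E: "E \<in> higgs_moduli (C t) D G"
      and nil: "\<And>P \<Phi>. (P, \<Phi>) \<in> E \<Longrightarrow> nilpotent_residues (C t) D G P \<Phi>"
      by (auto simp: stable_nil_moduli_def)
    obtain P \<Phi> where H: "(P, \<Phi>) \<in> E" using higgs_moduli_class(1)[OF E] by fastforce
    show ?thesis
      using hitchin_in_base(2)[OF C[OF t] curve(3) group generators higgs_moduli_class(2)[OF E H] nil[OF H]]
        higgs_moduli_class(3)[OF E H] by simp
  qed
  show ?thesis
  proof (intro conjI ballI)
    fix H :: "('p, 'c, 'n) pbundle \<times> ('p, 'c, 'n) higgs_field"
    assume "H \<in> log_higgs_bundles A D G"
    then show "case H of (P, \<Phi>) \<Rightarrow> nilpotent_residues A D G P \<Phi> \<longrightarrow>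
        hitchin A D l p (P, \<Phi>) \<in> hitchin_base A D l d (\<lambda>j. d j - 1)"
      using base by (cases H) simp
  next
    fix t assume t: "t \<in> teichmueller A D"
    show "hitchin_base (C t) D l d (\<lambda>j. d j - 1) \<subseteq> hitchin_base (C t) D l d d"
      by (rule sub)
    fix E :: "(('p, 'c, 'n) pbundle \<times> ('p, 'c, 'n) higgs_field) set"
    assume "E \<in> higgs_moduli (C t) D G"
    from moduli[OF t this]
    show "hitchin_map (C t) D l p E \<in> hitchin_base (C t) D l d d"
      and "\<And>H. H \<in> E \<Longrightarrow> hitchin_map (C t) D l p E = hitchin (C t) D l p H"
      by blast+
  next
    show "\<exists>h. \<forall>(t, E)\<in>M. h (t, E) \<in> hitchin_base (C t) D l d (\<lambda>j. d j - 1) \<and>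
        hitchin_map (C t) D l p E = h (t, E)"
      by (rule exI[of _ "\<lambda>(t, E). hitchin_map (C t) D l p E"]) (use factor in auto)
  qed
qed

end
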